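(* Let $m\ge n$ be positive integers. The module $$\bigoplus_{\underline t\in\mathcal{V}(\mathcal{P}_{n,m})\times\mathbb{K}^{|F_{n,m}|}}\mathcal{T}_{n,m}/M_{\underline t}$$ is faithful and semisimple over $\mathcal{T}_{n,m}$.
   Context: Let $\mathbb{K}$ be an algebraically closed field of characteristic zero. A semistandard Young tableau of partition shape $\lambda$ is a filling of the Ferrers diagram of $\lambda$ (English notation) with positive integers, strictly increasing down columns and weakly increasing from left to right along rows. For positive integers $m\ge n$, $\mathrm{SSYT}_m^n$ denotes the set of all semistandard Young tableaux of all partition shapes with at most $n$ rows and with entries in $\{1,\dots,m\}$ (including the empty tableau $\emptyset$). For $T$ of shape $\lambda$ and $T'$ of shape $\mu$, $T\star T'$ is the semistandard Young tableau of shape $\lambda+\mu$ obtained by horizontally concatenating the rows of $T$ and $T'$ and sorting the entries in each row in weakly increasing order. $(\mathrm{SSYT}_m^n,\star,\emptyset)$ is a commutative monoid, and the tableaux algebra $\mathcal{T}_{n,m}$ is its monoid algebra over $\mathbb{K}$. Let $G_{n,m}=\{T_1,\dots,T_d\}$ be the set of tableaux in $\mathrm{SSYT}_m^n$ with exactly one column (of height $1,\dots,n$). Write $[a_1,\dots,a_k]$ for the column with entries $a_1<\dots<a_k$ from top to bottom. Set $F_{n,n}=\{[n],\,[1,\dots,n-1],\,[1,\dots,n]\}$ (for $n=1$ this is just $\{[1]\}$), $F_{n,m}=\{[m],\,[1,\dots,n]\}$ if $m\ne n$, and $E_{n,m}=G_{n,m}\setminus F_{n,m}$. A product relation is a binomial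 $T_aT_b-T_cT_e$ with $T_a,T_b,T_c,T_e\in G_{n,m}$ distinct and $T_a\star T_b=T_c\star T_e$; all product relations involve only variables in $E_{n,m}$, and $\mathcal{P}_{n,m}$ is the ideal they generate in the polynomial ring $\mathbb{K}[E_{n,m}]$, with zero locus $\mathcal{V}(\mathcal{P}_{n,m})\subseteq\mathbb{K}^{|E_{n,m}|}$. For $\underline t=(t_i)_{1\le i\le d}\in\mathcal{V}(\mathcal{P}_{n,m})\times\mathbb{K}^{|F_{n,m}|}$ (coordinates indexed by $G_{n,m}$), $M_{\underline t}$ is the ideal of $\mathcal{T}_{n,m}$ generated by all $T_i-t_i$, $1\le i\le d$. *)

theory Defs
  imports
    "HOL-Algebra.Algebra"
    "HOL-Library.Poly_Mapping"
    "HOL-Library.Multiset"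
    "HOL-Computational_Algebra.Polynomial"
begin

section \<open>Semistandard Young tableaux\<close>

text \<open>
  A tableau is represented by the list of its rows, from top to bottom. Empty rows are
  excluded, so that the representation is unique and the row lengths form a partition.
\<close>

definition is_ssyt :: "nat list list \<Rightarrow> bool" where
  "is_ssyt rs \<longleftrightarrow>
     [] \<notin> set rs \<and>
     sorted_wrt (\<ge>) (map length rs) \<and>
     (\<forall>r\<in>set rs. sorted r \<and> (\<forall>x\<in>set r. 0 < x)) \<and>
     (\<forall>i j. Suc i < length rs \<and> j < length (rs ! Suc i) \<longrightarrow> rs ! i ! j < rs ! Suc i ! j)"

typedef ssyt = "{rs. is_ssyt rs}"
  morphisms rows Abs_ssyt
  by (rule exI[of _ "[]"]) (simp add: is_ssyt_def)

setup_lifting type_definition_ssyt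

fun star_rows :: "nat list list \<Rightarrow> nat list list \<Rightarrow> nat list list" where
  "star_rows [] ss = ss"
| "star_rows (r # rs) [] = r # rs"
| "star_rows (r # rs) (s # ss) = sort (r @ s) # star_rows rs ss"

text \<open>
  For sorted rows, \<open>fits_below x y\<close> says that \<open>y\<close> may be placed below \<open>x\<close> (see
  \<open>fits_below_iff\<close>). Counting entries makes this visibly compatible with concatenation and
  sorting; it is only used to show that semistandard tableaux are closed under \<open>\<star>\<close>.
\<close>

definition fits_below :: "nat list \<Rightarrow> nat list \<Rightarrow> bool" where
  "fits_below x y \<longleftrightarrow> (\<forall>v. length (filter (\<lambda>a. a \<le> v) y) \<le> length (filter (\<lambda>a. a < v) x))"

definition hd_row :: "nat list list \<Rightarrow> nat list" where
  "hd_row rs = (case rs of [] \<Rightarrow> [] | r # _ \<Rightarrow> r)"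

lemma hd_row_simps [simp]: "hd_row [] = []" "hd_row (r # rs) = r"
  by (simp_all add: hd_row_def)

lemma filter_sort_length: "length (filter P (sort xs)) = length (filter P xs)"
  by (metis length_sort filter_sort)

lemma sort_eqI: "mset xs = mset ys \<Longrightarrow> sort xs = sort ys"
  by (metis sorted_list_of_multiset_mset)

lemma fits_below_sort_append:
  "fits_below x y \<Longrightarrow> fits_below x' y' \<Longrightarrow> fits_below (sort (x @ x')) (sort (y @ y'))"
  unfolding fits_below_def filter_sort_length by (simp add: add_mono)

lemma fits_below_Nil [simp]: "fits_below x []"
  by (simp add: fits_below_def)

lemma fits_below_sort_append_left: "fits_below x y \<Longrightarrow> fits_below (sort (x @ x')) y"
  unfolding fits_below_def filter_sort_length by (simp add: trans_le_add1)

lemma fits_below_sort_append_right: "fits_below x y \<Longrightarrow> fits_below (sort (x' @ x)) y"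
  unfolding fits_below_def filter_sort_length by (simp add: trans_le_add2)

lemma sorted_filter_le_length:
  fixes y :: "nat list"
  assumes "sorted y" "j < length y" "P (y ! j)" "\<And>a b. a \<le> b \<Longrightarrow> P b \<Longrightarrow> P a"
  shows "j < length (filter P y)"
proof -
  have "{..j} \<subseteq> {i. i < length y \<and> P (y ! i)}"
    using assms by (auto intro: assms(4) sorted_nth_mono)
  then have "card {..j} \<le> card {i. i < length y \<and> P (y ! i)}"
    by (intro card_mono) auto
  then show ?thesis by (simp add: length_filter_conv_card)
qed

lemma sorted_filter_nth:
  fixes y :: "nat list"
  assumes "sorted y" "j < length (filter P y)" "\<And>a b. a \<le> b \<Longrightarrow> P b \<Longrightarrow> P a"
  shows "j < length y \<and> P (y ! j)"
proof -
  have l: "j < length y" using assms(2) length_filter_le less_le_trans by blast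
  have "P (y ! j)"
  proof (rule ccontr)
    assume np: "\<not> P (y ! j)"
    have "{i. i < length y \<and> P (y ! i)} \<subseteq> {..<j}"
    proof
      fix i assume "i \<in> {i. i < length y \<and> P (y ! i)}"
      then have i: "i < length y" "P (y ! i)" by auto
      show "i \<in> {..<j}"
      proof (rule ccontr)
        assume "i \<notin> {..<j}"
        then have "y ! j \<le> y ! i" using i(1) assms(1) by (simp add: sorted_nth_mono)
        then have "P (y ! j)" using i(2) by (rule assms(3))
        with np show False ..
      qed
    qed
    then have "card {i. i < length y \<and> P (y ! i)} \<le> card {..<j}"
      by (intro card_mono) auto
    then show False using assms(2) by (simp add: length_filter_conv_card)
  qed
  with l show ?thesis by simp
qed

lemma fits_below_iff:
  assumes "sorted x" "sorted y"
  shows "fits_below x y \<longleftrightarrow> length y \<le> length x \<and> (\<forall>j<length y. x ! j < y ! j)"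
proof
  assume d: "fits_below x y"
  have *: "j < length x \<and> x ! j < y ! j" if "j < length y" for j
  proof -
    have "j < length (filter (\<lambda>a. a \<le> y ! j) y)"
      by (rule sorted_filter_le_length) (use that assms in auto)
    also have "\<dots> \<le> length (filter (\<lambda>a. a < y ! j) x)"
      using d by (simp add: fits_below_def)
    finally show ?thesis
      by (intro sorted_filter_nth) (use assms in auto)
  qed
  moreover have "length y \<le> length x"
    using *[of "length x"] by (meson leI less_irrefl)
  ultimately show "length y \<le> length x \<and> (\<forall>j<length y. x ! j < y ! j)" by blast
next
  assume r: "length y \<le> length x \<and> (\<forall>j<length y. x ! j < y ! j)"
  show "fits_below x y"
    unfolding fits_below_def
  proof
    fix v
    have "{i. i < length y \<and> y ! i \<le> v} \<subseteq> {i. i < length x \<and> x ! i < v}"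
      using r by (auto intro: less_le_trans)
    then show "length (filter (\<lambda>a. a \<le> v) y) \<le> length (filter (\<lambda>a. a < v) x)"
      unfolding length_filter_conv_card by (intro card_mono) auto
  qed
qed

lemma is_ssyt_Nil: "is_ssyt []"
  by (simp add: is_ssyt_def)

lemma is_ssyt_Cons:
  "is_ssyt (r # rs) \<longleftrightarrow>
     r \<noteq> [] \<and> sorted r \<and> (\<forall>x\<in>set r. 0 < x) \<and> fits_below r (hd_row rs) \<and> is_ssyt rs"
proof (cases rs)
  case Nil
  then show ?thesis by (auto simp: is_ssyt_def)
next
  case (Cons s ss)
  have col: "(\<forall>i j. Suc i < length (r # rs) \<and> j < length ((r # rs) ! Suc i)
        \<longrightarrow> (r # rs) ! i ! j < (r # rs) ! Suc i ! j) \<longleftrightarrow>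
      (\<forall>j<length s. r ! j < s ! j) \<and>
      (\<forall>i j. Suc i < length rs \<and> j < length (rs ! Suc i) \<longrightarrow> rs ! i ! j < rs ! Suc i ! j)"
    (is "?L \<longleftrightarrow> ?A \<and> ?B")
  proof
    assume L: ?L
    have ?A using L[rule_format, of 0] Cons by auto
    moreover have ?B
    proof (intro allI impI)
      fix i j assume "Suc i < length rs \<and> j < length (rs ! Suc i)"
      then show "rs ! i ! j < rs ! Suc i ! j" using L[rule_format, of "Suc i" j] by simp
    qed
    ultimately show "?A \<and> ?B" by blast
  next
    assume AB: "?A \<and> ?B"
    show ?L
    proof (intro allI impI)
      fix i j assume "Suc i < length (r # rs) \<and> j < length ((r # rs) ! Suc i)"
      then show "(r # rs) ! i ! j < (r # rs) ! Suc i ! j"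
        using AB Cons by (cases i) auto
    qed
  qed
  have len: "sorted_wrt (\<ge>) (map length (r # rs)) \<longleftrightarrow>
      length s \<le> length r \<and> sorted_wrt (\<ge>) (map length rs)"
    using Cons by auto
  show ?thesis
    unfolding is_ssyt_def col len using Cons by (auto simp: fits_below_iff)
qed

lemma star_rows_Nil2 [simp]: "star_rows rs [] = rs"
  by (cases rs) auto

lemma hd_row_star_rows: "hd_row (star_rows rs ss) =
   (if rs = [] then hd_row ss else if ss = [] then hd_row rs else sort (hd_row rs @ hd_row ss))"
  by (induction rs ss rule: star_rows.induct) auto

lemma is_ssyt_star_rows: "is_ssyt rs \<Longrightarrow> is_ssyt ss \<Longrightarrow> is_ssyt (star_rows rs ss)"
proof (induction rs ss rule: star_rows.induct)
  case (3 r rs s ss)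
  have d: "fits_below r (hd_row rs)" "fits_below s (hd_row ss)"
    using 3 by (auto simp: is_ssyt_Cons)
  have "fits_below (sort (r @ s)) (hd_row (star_rows rs ss))"
    unfolding hd_row_star_rows
    using d by (auto intro: fits_below_sort_append fits_below_sort_append_left fits_below_sort_append_right)
  moreover have "sort (r @ s) \<noteq> []"
    using 3 by (metis append_is_Nil_conv is_ssyt_Cons length_0_conv length_sort)
  ultimately show ?case
    using 3 by (auto simp: is_ssyt_Cons)
qed auto

lemma star_rows_commute: "star_rows rs ss = star_rows ss rs"
  by (induction rs ss rule: star_rows.induct) (auto intro: sort_eqI)

lemma star_rows_assoc: "star_rows (star_rows rs ss) ts = star_rows rs (star_rows ss ts)"
proof (induction rs ss arbitrary: ts rule: star_rows.induct)
  case (3 r rs s ss)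
  then show ?case by (cases ts) (auto intro!: sort_eqI simp: ac_simps)
qed auto

text \<open>The sum of tableaux is the operation \<open>\<star>\<close>, and \<open>0\<close> is the empty tableau.\<close>

instantiation ssyt :: comm_monoid_add
begin

lift_definition zero_ssyt :: ssyt is "[]"
  by (rule is_ssyt_Nil)

lift_definition plus_ssyt :: "ssyt \<Rightarrow> ssyt \<Rightarrow> ssyt" is star_rows
  by (rule is_ssyt_star_rows)

instance
proof
  fix a b c :: ssyt
  show "a + b + c = a + (b + c)" by transfer (rule star_rows_assoc)
  show "a + b = b + a" by transfer (rule star_rows_commute)
  show "0 + a = a" by transfer simp
qed

end

definition SSYT :: "nat \<Rightarrow> nat \<Rightarrow> ssyt set" where
  "SSYT n m = {T. length (rows T) \<le> n \<and> (\<forall>r\<in>set (rows T). set r \<subseteq> {1..m})}"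

definition G_set :: "nat \<Rightarrow> nat \<Rightarrow> ssyt set" where
  "G_set n m = {T \<in> SSYT n m. rows T \<noteq> [] \<and> (\<forall>r\<in>set (rows T). length r = 1)}"

text \<open>Only meaningful for strictly increasing lists of positive integers.\<close>

definition column :: "nat list \<Rightarrow> ssyt" where
  "column as = Abs_ssyt (map (\<lambda>a. [a]) as)"

definition F_set :: "nat \<Rightarrow> nat \<Rightarrow> ssyt set" where
  "F_set n m =
     (if m \<noteq> n then {column [m], column [1..<Suc n]}
      else if n = 1 then {column [1]}
      else {column [n], column [1..<n], column [1..<Suc n]})"

definition E_set :: "nat \<Rightarrow> nat \<Rightarrow> ssyt set" where
  "E_set n m = G_set n m - F_set n m"


section \<open>Monoid algebras, the tableaux algebra and polynomial rings\<close>

text \<open>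
  The multiplication of \<^typ>\<open>'m \<Rightarrow>\<^sub>0 'k\<close> is convolution, so this is the monoid algebra of a
  submonoid \<open>S\<close>. The basis element of \<open>s\<close> is \<open>Poly_Mapping.single s 1\<close>, and the scalar \<open>c\<close>
  is \<open>Poly_Mapping.single 0 c\<close>.
\<close>

definition monoid_algebra :: "'m::comm_monoid_add set \<Rightarrow> ('m \<Rightarrow>\<^sub>0 'k::comm_ring_1) ring" where
  "monoid_algebra S =
     \<lparr>carrier = {f. Poly_Mapping.keys f \<subseteq> S},
      monoid.mult = (*), one = 1, ring.zero = 0, ring.add = (+)\<rparr>"

definition tableaux_algebra :: "nat \<Rightarrow> nat \<Rightarrow> (ssyt \<Rightarrow>\<^sub>0 'k::comm_ring_1) ring" where
  "tableaux_algebra n m = monoid_algebra (SSYT n m)"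

text \<open>A monomial is the multiset of its variables.\<close>

definition polynomial_ring :: "'v set \<Rightarrow> ('v multiset \<Rightarrow>\<^sub>0 'k::comm_ring_1) ring" where
  "polynomial_ring V = monoid_algebra {mon. set_mset mon \<subseteq> V}"

definition Var :: "'v \<Rightarrow> 'v multiset \<Rightarrow>\<^sub>0 'k::comm_ring_1" where
  "Var v = Poly_Mapping.single {#v#} 1"

definition poly_eval :: "('v \<Rightarrow> 'k) \<Rightarrow> ('v multiset \<Rightarrow>\<^sub>0 'k::comm_ring_1) \<Rightarrow> 'k" where
  "poly_eval t p =
     (\<Sum>mon\<in>Poly_Mapping.keys p. Poly_Mapping.lookup p mon * (\<Prod>v\<in>#mon. t v))"

definition zero_locus :: "'v set \<Rightarrow> ('v multiset \<Rightarrow>\<^sub>0 'k::comm_ring_1) set \<Rightarrow> ('v \<Rightarrow> 'k) set" where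
  "zero_locus V I = {t \<in> V \<rightarrow>\<^sub>E UNIV. \<forall>p\<in>I. poly_eval t p = 0}"

definition product_relations :: "nat \<Rightarrow> nat \<Rightarrow> (ssyt multiset \<Rightarrow>\<^sub>0 'k::comm_ring_1) set" where
  "product_relations n m =
     {Var a * Var b - Var c * Var e | a b c e.
        {a, b, c, e} \<subseteq> G_set n m \<and> distinct [a, b, c, e] \<and> a + b = c + e}"

definition P_ideal :: "nat \<Rightarrow> nat \<Rightarrow> (ssyt multiset \<Rightarrow>\<^sub>0 'k::comm_ring_1) set" where
  "P_ideal n m = genideal (polynomial_ring (E_set n m)) (product_relations n m)"

text \<open>
  The product of the zero locus with the affine space on \<open>F_set n m\<close>: since \<open>G_set n m\<close> is
  the disjoint union of \<open>E_set n m\<close> and \<open>F_set n m\<close>, a point is given by its two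
  restrictions.
\<close>

definition points :: "nat \<Rightarrow> nat \<Rightarrow> (ssyt \<Rightarrow> 'k::comm_ring_1) set" where
  "points n m =
     {t \<in> G_set n m \<rightarrow>\<^sub>E UNIV.
        restrict t (E_set n m) \<in> zero_locus (E_set n m) (P_ideal n m) \<and>
        restrict t (F_set n m) \<in> F_set n m \<rightarrow>\<^sub>E UNIV}"

definition M_ideal :: "nat \<Rightarrow> nat \<Rightarrow> (ssyt \<Rightarrow> 'k::comm_ring_1) \<Rightarrow> (ssyt \<Rightarrow>\<^sub>0 'k) set" where
  "M_ideal n m t =
     genideal (tableaux_algebra n m)
       {Poly_Mapping.single T 1 - Poly_Mapping.single 0 (t T) | T. T \<in> G_set n m}"


section \<open>Modules\<close>

text \<open>
  The record type of modules extends that of rings; the components \<open>mult\<close> and \<open>one\<close> play no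
  role for modules.
\<close>

definition quotient_module :: "('a, 'c) ring_scheme \<Rightarrow> 'a set \<Rightarrow> ('a, 'a set) module" where
  "quotient_module R I =
     \<lparr>carrier = carrier (R Quot I), monoid.mult = undefined, one = undefined,
      ring.zero = \<zero>\<^bsub>R Quot I\<^esub>, ring.add = (\<oplus>\<^bsub>R Quot I\<^esub>),
      module.smult = (\<lambda>a C. (I +>\<^bsub>R\<^esub> a) \<otimes>\<^bsub>R Quot I\<^esub> C)\<rparr>"

definition direct_sum :: "'i set \<Rightarrow> ('i \<Rightarrow> ('a, 'b, 'c) module_scheme) \<Rightarrow> ('a, 'i \<Rightarrow> 'b) module"
  where
  "direct_sum I M =
     \<lparr>carrier = {f \<in> (\<Pi>\<^sub>E i\<in>I. carrier (M i)). finite {i \<in> I. f i \<noteq> \<zero>\<^bsub>M i\<^esub>}},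
      monoid.mult = undefined, one = undefined,
      ring.zero = (\<lambda>i\<in>I. \<zero>\<^bsub>M i\<^esub>), ring.add = (\<lambda>f g. \<lambda>i\<in>I. f i \<oplus>\<^bsub>M i\<^esub> g i),
      module.smult = (\<lambda>r f. \<lambda>i\<in>I. r \<odot>\<^bsub>M i\<^esub> f i)\<rparr>"

definition faithful_module :: "('a, 'c) ring_scheme \<Rightarrow> ('a, 'b, 'd) module_scheme \<Rightarrow> bool" where
  "faithful_module R M \<longleftrightarrow>
     module R M \<and>
     (\<forall>r\<in>carrier R. (\<forall>x\<in>carrier M. r \<odot>\<^bsub>M\<^esub> x = \<zero>\<^bsub>M\<^esub>) \<longrightarrow> r = \<zero>\<^bsub>R\<^esub>)"

definition simple_module :: "('a, 'c) ring_scheme \<Rightarrow> ('a, 'b, 'd) module_scheme \<Rightarrow> bool" where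
  "simple_module R M \<longleftrightarrow>
     module R M \<and> carrier M \<noteq> {\<zero>\<^bsub>M\<^esub>} \<and>
     (\<forall>N. submodule N R M \<longrightarrow> N = {\<zero>\<^bsub>M\<^esub>} \<or> N = carrier M)"

text \<open>
  A module is semisimple if it is the internal direct sum of a family of simple submodules,
  i.e. the summation map from their external direct sum is bijective. A set suffices as
  index, since the members of a direct sum of nonzero submodules are pairwise distinct.
\<close>

definition semisimple_module :: "('a, 'c) ring_scheme \<Rightarrow> ('a, 'b, 'd) module_scheme \<Rightarrow> bool" where
  "semisimple_module R M \<longleftrightarrow>
     module R M \<and>
     (\<exists>\<S>. (\<forall>S\<in>\<S>. submodule S R M \<and> simple_module R (M\<lparr>carrier := S\<rparr>)) \<and>
          bij_betw (\<lambda>f. \<Oplus>\<^bsub>M\<^esub>S\<in>{S \<in> \<S>. f S \<noteq> \<zero>\<^bsub>M\<^esub>}. f S)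
            (carrier (direct_sum \<S> (\<lambda>S. M\<lparr>carrier := S\<rparr>))) (carrier M))"

end

theory Submission
  imports Defs "HOL-Library.Infinite_Set" "HOL-Library.Nat_Bijection"
    "HOL-Computational_Algebra.Primes"
begin

text \<open>
  Write \<open>A\<close> for the tableaux algebra. Semisimplicity and faithfulness have separate causes.

  Semisimplicity. Peeling off first columns writes every tableau as a \<open>\<star>\<close>-product of
  one-column tableaux (\<open>split_first_column\<close>). Modulo \<open>M_ideal n m t\<close> each one-column tableau is
  a scalar, so every element of \<open>A\<close> is a scalar (\<open>scalar_mod_M_ideal\<close>). Hence the ideal is
  either all of \<open>A\<close> or maximal, and the quotient module is zero or simple. A direct sum of modules
  each of which is zero or simple is semisimple (\<open>semisimple_direct_sum\<close>).

  Faithfulness. An element annihilating the whole sum lies in every \<open>M_ideal n m t\<close>. A character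
  \<open>\<chi>\<close>, that is, a monoid homomorphism from tableaux to the multiplicative monoid of the field,
  extends linearly to a ring homomorphism on \<open>A\<close>. Its restriction to the one-column tableaux is a
  point \<open>t\<close> (\<open>restrict_character_in_points\<close>), and \<open>M_ideal n m t\<close> lies in the kernel of the
  extension. It is therefore enough that characters separate the elements of \<open>A\<close> from zero
  (\<open>ex_character_nonzero\<close>). Assigning distinct primes to the pairs of a row and an entry and
  multiplying over all cells gives each tableau a Goedel number. These numbers are multiplicative
  under \<open>\<star>\<close>, and unique factorization makes them distinct, also in the field, since it has
  characteristic zero. The powers of this one character separate by Vandermonde.

  That the restriction of a character is a point needs one fact on columns: the members of
  \<open>F_set n m\<close> occur in no product relation (\<open>product_relation_not_F\<close>). Thus the product relations
  lie in the polynomial ring on \<open>E_set n m\<close>, and the kernel of evaluation at the character is an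
  ideal of that ring containing them.
\<close>

section \<open>Direct sums of modules\<close>

text \<open>
  The elements of the direct sum \<open>D\<close> are extensional functions with finite support, so
  identities in \<open>D\<close> are checked one coordinate at a time.
\<close>

locale module_family =
  fixes R :: "('a, 'c) ring_scheme" and I :: "'i set" and M :: "'i \<Rightarrow> ('a, 'b, 'd) module_scheme"
  assumes cring: "cring R" and module: "\<And>i. i \<in> I \<Longrightarrow> module R (M i)"
begin

abbreviation D where "D \<equiv> direct_sum I M"

lemma abelian_group_component: "i \<in> I \<Longrightarrow> abelian_group (M i)"
  using module by (simp add: module_def)

lemma abelian_monoid_component: "i \<in> I \<Longrightarrow> abelian_monoid (M i)"
  using abelian_group_component by (simp add: abelian_group_def)

lemma zero_in_component [simp]: "i \<in> I \<Longrightarrow> \<zero>\<^bsub>M i\<^esub> \<in> carrier (M i)"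
  by (rule abelian_monoid.zero_closed[OF abelian_monoid_component])

lemma carrier_direct_sum:
  "f \<in> carrier D \<longleftrightarrow>
     f \<in> extensional I \<and> (\<forall>i\<in>I. f i \<in> carrier (M i)) \<and> finite {i \<in> I. f i \<noteq> \<zero>\<^bsub>M i\<^esub>}"
  by (auto simp: direct_sum_def PiE_def)

lemma direct_sum_apply:
  assumes "i \<in> I"
  shows "\<zero>\<^bsub>D\<^esub> i = \<zero>\<^bsub>M i\<^esub>" "(f \<oplus>\<^bsub>D\<^esub> g) i = f i \<oplus>\<^bsub>M i\<^esub> g i" "(r \<odot>\<^bsub>D\<^esub> f) i = r \<odot>\<^bsub>M i\<^esub> f i"
  using assms by (simp_all add: direct_sum_def)

lemma direct_sum_extensional:
  "\<zero>\<^bsub>D\<^esub> \<in> extensional I" "f \<oplus>\<^bsub>D\<^esub> g \<in> extensional I" "r \<odot>\<^bsub>D\<^esub> f \<in> extensional I"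
  by (simp_all add: direct_sum_def)

lemma direct_sum_eqI:
  assumes "f \<in> extensional I" "g \<in> extensional I" "\<And>i. i \<in> I \<Longrightarrow> f i = g i"
  shows "f = g"
  using assms by (rule extensionalityI)

lemma zero_direct_sum: "\<zero>\<^bsub>D\<^esub> \<in> carrier D"
proof -
  have "{i \<in> I. \<zero>\<^bsub>D\<^esub> i \<noteq> \<zero>\<^bsub>M i\<^esub>} = {}" by (auto simp: direct_sum_apply)
  then have "finite {i \<in> I. \<zero>\<^bsub>D\<^esub> i \<noteq> \<zero>\<^bsub>M i\<^esub>}" by (simp only: finite.emptyI)
  then show ?thesis
    unfolding carrier_direct_sum by (simp add: direct_sum_apply direct_sum_extensional)
qed

lemma add_direct_sum:
  assumes "f \<in> carrier D" "g \<in> carrier D"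
  shows "f \<oplus>\<^bsub>D\<^esub> g \<in> carrier D"
proof -
  have "{i \<in> I. (f \<oplus>\<^bsub>D\<^esub> g) i \<noteq> \<zero>\<^bsub>M i\<^esub>} \<subseteq> {i \<in> I. f i \<noteq> \<zero>\<^bsub>M i\<^esub>} \<union> {i \<in> I. g i \<noteq> \<zero>\<^bsub>M i\<^esub>}"
    using abelian_monoid.l_zero[OF abelian_monoid_component]
    by (auto simp: direct_sum_apply)
  then have "finite {i \<in> I. (f \<oplus>\<^bsub>D\<^esub> g) i \<noteq> \<zero>\<^bsub>M i\<^esub>}"
    using assms unfolding carrier_direct_sum by (meson finite_UnI finite_subset)
  then show ?thesis
    using assms abelian_monoid.a_closed[OF abelian_monoid_component]
    unfolding carrier_direct_sum by (simp add: direct_sum_apply direct_sum_extensional)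
qed

lemma smult_direct_sum:
  assumes "r \<in> carrier R" "f \<in> carrier D"
  shows "r \<odot>\<^bsub>D\<^esub> f \<in> carrier D"
proof -
  have "{i \<in> I. (r \<odot>\<^bsub>D\<^esub> f) i \<noteq> \<zero>\<^bsub>M i\<^esub>} \<subseteq> {i \<in> I. f i \<noteq> \<zero>\<^bsub>M i\<^esub>}"
    using assms module.smult_r_null[OF module]
    by (auto simp: direct_sum_apply)
  then have "finite {i \<in> I. (r \<odot>\<^bsub>D\<^esub> f) i \<noteq> \<zero>\<^bsub>M i\<^esub>}"
    using assms unfolding carrier_direct_sum by (meson finite_subset)
  then show ?thesis
    using assms module.smult_closed[OF module]
    unfolding carrier_direct_sum by (simp add: direct_sum_apply direct_sum_extensional)
qed

lemma abelian_group_direct_sum: "abelian_group D"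
proof (rule abelian_groupI)
  fix f assume f: "f \<in> carrier D"
  define g where "g = (\<lambda>i\<in>I. \<ominus>\<^bsub>M i\<^esub> f i)"
  have "{i \<in> I. g i \<noteq> \<zero>\<^bsub>M i\<^esub>} \<subseteq> {i \<in> I. f i \<noteq> \<zero>\<^bsub>M i\<^esub>}"
    by (auto simp: g_def a_inv_def monoid.inv_one[OF abelian_monoid.a_monoid[OF abelian_monoid_component], simplified])
  then have "finite {i \<in> I. g i \<noteq> \<zero>\<^bsub>M i\<^esub>}"
    using f unfolding carrier_direct_sum by (meson finite_subset)
  then have "g \<in> carrier D"
    using f abelian_group.a_inv_closed[OF abelian_group_component]
    unfolding carrier_direct_sum by (simp add: g_def)
  moreover have "g \<oplus>\<^bsub>D\<^esub> f = \<zero>\<^bsub>D\<^esub>"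
    using f abelian_group.l_neg[OF abelian_group_component]
    by (intro direct_sum_eqI) (simp_all add: direct_sum_apply direct_sum_extensional g_def carrier_direct_sum)
  ultimately show "\<exists>g\<in>carrier D. g \<oplus>\<^bsub>D\<^esub> f = \<zero>\<^bsub>D\<^esub>" by blast
next
  fix f g h assume "f \<in> carrier D" "g \<in> carrier D" "h \<in> carrier D"
  then show "f \<oplus>\<^bsub>D\<^esub> g \<oplus>\<^bsub>D\<^esub> h = f \<oplus>\<^bsub>D\<^esub> (g \<oplus>\<^bsub>D\<^esub> h)"
    using abelian_monoid.a_assoc[OF abelian_monoid_component]
    by (intro direct_sum_eqI) (simp_all add: direct_sum_apply direct_sum_extensional carrier_direct_sum)
next
  fix f g assume "f \<in> carrier D" "g \<in> carrier D"
  then show "f \<oplus>\<^bsub>D\<^esub> g = g \<oplus>\<^bsub>D\<^esub> f"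
    using abelian_monoid.a_comm[OF abelian_monoid_component]
    by (intro direct_sum_eqI) (simp_all add: direct_sum_apply direct_sum_extensional carrier_direct_sum)
next
  fix f assume "f \<in> carrier D"
  then show "\<zero>\<^bsub>D\<^esub> \<oplus>\<^bsub>D\<^esub> f = f"
    using abelian_monoid.l_zero[OF abelian_monoid_component]
    by (intro direct_sum_eqI) (simp_all add: direct_sum_apply direct_sum_extensional carrier_direct_sum)
qed (auto intro: zero_direct_sum add_direct_sum)

lemma module_direct_sum: "module R D"
proof (rule moduleI)
  show "cring R" by (rule cring)
  show "abelian_group D" by (rule abelian_group_direct_sum)
  show "r \<odot>\<^bsub>D\<^esub> f \<in> carrier D" if "r \<in> carrier R" "f \<in> carrier D" for r f
    using that by (rule smult_direct_sum)
next
  fix a b f assume "a \<in> carrier R" "b \<in> carrier R" "f \<in> carrier D"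
  then show "(a \<oplus>\<^bsub>R\<^esub> b) \<odot>\<^bsub>D\<^esub> f = a \<odot>\<^bsub>D\<^esub> f \<oplus>\<^bsub>D\<^esub> b \<odot>\<^bsub>D\<^esub> f"
    using module.smult_l_distr[OF module]
    by (intro direct_sum_eqI) (simp_all add: direct_sum_apply direct_sum_extensional carrier_direct_sum)
next
  fix a f g assume "a \<in> carrier R" "f \<in> carrier D" "g \<in> carrier D"
  then show "a \<odot>\<^bsub>D\<^esub> (f \<oplus>\<^bsub>D\<^esub> g) = a \<odot>\<^bsub>D\<^esub> f \<oplus>\<^bsub>D\<^esub> a \<odot>\<^bsub>D\<^esub> g"
    using module.smult_r_distr[OF module]
    by (intro direct_sum_eqI) (simp_all add: direct_sum_apply direct_sum_extensional carrier_direct_sum)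
next
  fix a b f assume "a \<in> carrier R" "b \<in> carrier R" "f \<in> carrier D"
  then show "(a \<otimes>\<^bsub>R\<^esub> b) \<odot>\<^bsub>D\<^esub> f = a \<odot>\<^bsub>D\<^esub> (b \<odot>\<^bsub>D\<^esub> f)"
    using module.smult_assoc1[OF module]
    by (intro direct_sum_eqI) (simp_all add: direct_sum_apply direct_sum_extensional carrier_direct_sum)
next
  fix f assume "f \<in> carrier D"
  then show "\<one>\<^bsub>R\<^esub> \<odot>\<^bsub>D\<^esub> f = f"
    using module.smult_one[OF module]
    by (intro direct_sum_eqI) (simp_all add: direct_sum_apply direct_sum_extensional carrier_direct_sum)
qed

sublocale D: module R D
  by (rule module_direct_sum)

definition incl :: "'i \<Rightarrow> 'b \<Rightarrow> 'i \<Rightarrow> 'b" where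
  "incl i x = (\<lambda>j\<in>I. if j = i then x else \<zero>\<^bsub>M j\<^esub>)"

definition summand :: "'i \<Rightarrow> ('i \<Rightarrow> 'b) set" where
  "summand i = {f \<in> carrier D. \<forall>j\<in>I. j \<noteq> i \<longrightarrow> f j = \<zero>\<^bsub>M j\<^esub>}"

lemma incl_in_summand:
  assumes "i \<in> I" "x \<in> carrier (M i)"
  shows "incl i x \<in> summand i"
proof -
  have "finite {j \<in> I. incl i x j \<noteq> \<zero>\<^bsub>M j\<^esub>}"
    by (rule finite_subset[of _ "{i}"]) (auto simp: incl_def)
  then show ?thesis
    using assms unfolding summand_def by (auto simp: carrier_direct_sum incl_def)
qed

lemma incl_same [simp]: "i \<in> I \<Longrightarrow> incl i x i = x"
  by (simp add: incl_def)

lemma incl_component: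
  assumes "f \<in> summand i"
  shows "incl i (f i) = f"
  using assms by (intro direct_sum_eqI) (auto simp: summand_def incl_def carrier_direct_sum)

lemma incl_zero: "i \<in> I \<Longrightarrow> incl i \<zero>\<^bsub>M i\<^esub> = \<zero>\<^bsub>D\<^esub>"
  by (intro direct_sum_eqI) (auto simp: incl_def direct_sum_apply direct_sum_extensional)

lemma submodule_summand: "submodule (summand i) R D"
proof (rule D.submoduleI)
  show "summand i \<subseteq> carrier D" by (auto simp: summand_def)
  show "\<zero>\<^bsub>D\<^esub> \<in> summand i" by (auto simp: summand_def direct_sum_apply)
  show add: "f \<oplus>\<^bsub>D\<^esub> g \<in> summand i" if "f \<in> summand i" "g \<in> summand i" for f g
    using that abelian_monoid.l_zero[OF abelian_monoid_component]
    by (auto simp: summand_def direct_sum_apply)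
  show smult: "r \<odot>\<^bsub>D\<^esub> f \<in> summand i" if "r \<in> carrier R" "f \<in> summand i" for r f
    using that module.smult_r_null[OF module]
    by (auto simp: summand_def direct_sum_apply)
  fix f assume f: "f \<in> summand i"
  then have "\<ominus>\<^bsub>D\<^esub> f = (\<ominus>\<^bsub>R\<^esub> \<one>\<^bsub>R\<^esub>) \<odot>\<^bsub>D\<^esub> f"
    by (simp add: D.smult_l_minus summand_def)
  then show "\<ominus>\<^bsub>D\<^esub> f \<in> summand i" using f smult by simp
qed

text \<open>
  Evaluation at \<open>i\<close> and the inclusion of the \<open>i\<close>-th component are mutually inverse between
  \<open>summand i\<close> and the component, so a submodule of the summand is determined by its image in the
  simple module \<open>M i\<close>.
\<close>

lemma simple_summand:
  assumes i: "i \<in> I" and simple: "simple_module R (M i)"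
  shows "simple_module R (D\<lparr>carrier := summand i\<rparr>)"
  unfolding simple_module_def
proof (intro conjI allI impI)
  let ?S = "D\<lparr>carrier := summand i\<rparr>"
  interpret Mi: module R "M i" by (rule module[OF i])
  show mod: "module R ?S"
    by (rule submodule.submodule_is_module[OF submodule_summand module_direct_sum])
  interpret S: module R ?S by (rule mod)
  obtain x where x: "x \<in> carrier (M i)" "x \<noteq> \<zero>\<^bsub>M i\<^esub>"
    using simple unfolding simple_module_def by auto
  then have "incl i x \<in> summand i" "incl i x \<noteq> \<zero>\<^bsub>D\<^esub>"
    using i incl_in_summand by (auto simp: direct_sum_apply dest: fun_cong[where x = i])
  then show "carrier ?S \<noteq> {\<zero>\<^bsub>?S\<^esub>}" by auto
  fix N assume N: "submodule N R ?S"
  have Nsub: "N \<subseteq> summand i" using S.submoduleE(1)[OF N] by simp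
  have Nadd: "f \<oplus>\<^bsub>D\<^esub> g \<in> N" if "f \<in> N" "g \<in> N" for f g
    using S.submoduleE(5)[OF N that] by simp
  have Nsm: "r \<odot>\<^bsub>D\<^esub> f \<in> N" if "r \<in> carrier R" "f \<in> N" for r f
    using S.submoduleE(4)[OF N that] by simp
  have N0: "\<zero>\<^bsub>D\<^esub> \<in> N"
    using subgroup.one_closed[OF submodule.axioms(1)[OF N]] by simp
  let ?p = "\<lambda>f. f i"
  have sm: "r \<odot>\<^bsub>M i\<^esub> a \<in> ?p ` N" if "r \<in> carrier R" "a \<in> ?p ` N" for r a
  proof -
    obtain f where "f \<in> N" "a = f i" using \<open>a \<in> ?p ` N\<close> by blast
    then show ?thesis
      using Nsm[OF \<open>r \<in> carrier R\<close>, of f] direct_sum_apply(3)[OF i, of r f]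
      by (intro image_eqI[of _ _ "r \<odot>\<^bsub>D\<^esub> f"]) auto
  qed
  have "submodule (?p ` N) R (M i)"
  proof (rule Mi.submoduleI)
    show sub: "?p ` N \<subseteq> carrier (M i)"
      using Nsub i by (auto simp: summand_def carrier_direct_sum)
    show "\<zero>\<^bsub>M i\<^esub> \<in> ?p ` N"
      using N0 direct_sum_apply(1)[OF i] by (intro image_eqI[of _ _ "\<zero>\<^bsub>D\<^esub>"]) auto
    show "a \<oplus>\<^bsub>M i\<^esub> b \<in> ?p ` N" if "a \<in> ?p ` N" "b \<in> ?p ` N" for a b
    proof -
      obtain f g where "f \<in> N" "a = f i" "g \<in> N" "b = g i"
        using \<open>a \<in> ?p ` N\<close> \<open>b \<in> ?p ` N\<close> by blast
      then show ?thesis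
        using Nadd[of f g] direct_sum_apply(2)[OF i, of f g]
        by (intro image_eqI[of _ _ "f \<oplus>\<^bsub>D\<^esub> g"]) auto
    qed
    show "r \<odot>\<^bsub>M i\<^esub> a \<in> ?p ` N" if "r \<in> carrier R" "a \<in> ?p ` N" for r a
      using that by (rule sm)
    fix a assume a: "a \<in> ?p ` N"
    then have "\<ominus>\<^bsub>M i\<^esub> a = (\<ominus>\<^bsub>R\<^esub> \<one>\<^bsub>R\<^esub>) \<odot>\<^bsub>M i\<^esub> a"
      using sub by (subst Mi.smult_l_minus) auto
    then show "\<ominus>\<^bsub>M i\<^esub> a \<in> ?p ` N" using a sm by simp
  qed
  then consider "?p ` N = {\<zero>\<^bsub>M i\<^esub>}" | "?p ` N = carrier (M i)"
    using simple unfolding simple_module_def by blast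
  then show "N = {\<zero>\<^bsub>?S\<^esub>} \<or> N = carrier ?S"
  proof cases
    case 1
    then have "f = \<zero>\<^bsub>D\<^esub>" if "f \<in> N" for f
    proof -
      have "f i = \<zero>\<^bsub>M i\<^esub>" using 1 that by blast
      moreover have "incl i (f i) = f" using that Nsub by (intro incl_component) blast
      ultimately show ?thesis using incl_zero[OF i] by simp
    qed
    then have "N = {\<zero>\<^bsub>D\<^esub>}" using N0 by blast
    then show ?thesis by simp
  next
    case 2
    have "f \<in> N" if f: "f \<in> summand i" for f
    proof -
      have "f i \<in> ?p ` N" using f i 2 by (auto simp: summand_def carrier_direct_sum)
      then obtain g where "g \<in> N" "g i = f i" by auto
      moreover have "incl i (f i) = f" by (rule incl_component[OF f])
      moreover have "incl i (g i) = g" using \<open>g \<in> N\<close> Nsub by (intro incl_component) blast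
      ultimately show ?thesis by simp
    qed
    then have "N = summand i" using Nsub by blast
    then show ?thesis by simp
  qed
qed

lemma finsum_direct_sum_apply:
  assumes "finite A" "h \<in> A \<rightarrow> carrier D" "i \<in> I"
  shows "(\<Oplus>\<^bsub>D\<^esub>a\<in>A. h a) i = (\<Oplus>\<^bsub>M i\<^esub>a\<in>A. h a i)"
  using assms(1,2)
proof (induction A)
  case empty
  then show ?case
    using assms(3) by (simp add: direct_sum_apply abelian_monoid.finsum_empty[OF abelian_monoid_component])
next
  case (insert a A)
  have "(\<lambda>b. h b i) \<in> A \<rightarrow> carrier (M i)" "h a i \<in> carrier (M i)"
    using insert.prems assms(3) by (auto simp: carrier_direct_sum Pi_iff)
  then show ?case
    using insert assms(3)
    by (simp add: direct_sum_apply Pi_iff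
        abelian_monoid.finsum_insert[OF abelian_monoid_component[OF assms(3)]])
qed

text \<open>
  The simple submodules are the summands of the nonzero components. Distinct nonzero components give
  distinct summands, so these can be indexed by themselves. The coordinate \<open>i\<close> of a sum
  of elements of the summands only sees the element of \<open>summand i\<close>: this recovers the family from
  its sum (injectivity) and tells which family to take for a given element (surjectivity).
  Zero components contribute nothing on either side.
\<close>

lemma semisimple_direct_sum:
  assumes simple: "\<And>i. i \<in> I \<Longrightarrow> carrier (M i) \<noteq> {\<zero>\<^bsub>M i\<^esub>} \<Longrightarrow> simple_module R (M i)"
  shows "semisimple_module R D"
proof -
  define J where "J = {i \<in> I. carrier (M i) \<noteq> {\<zero>\<^bsub>M i\<^esub>}}"
  define SS where "SS = summand ` J"
  let ?E = "direct_sum SS (\<lambda>S. D\<lparr>carrier := S\<rparr>)"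
  let ?\<Phi> = "\<lambda>f. \<Oplus>\<^bsub>D\<^esub>S\<in>{S \<in> SS. f S \<noteq> \<zero>\<^bsub>D\<^esub>}. f S"
  have JI: "J \<subseteq> I" by (auto simp: J_def)
  have inj: "inj_on summand J"
  proof
    fix i j assume ij: "i \<in> J" "j \<in> J" "summand i = summand j"
    then obtain x where x: "x \<in> carrier (M i)" "x \<noteq> \<zero>\<^bsub>M i\<^esub>" and i: "i \<in> I"
      using zero_in_component by (fastforce simp: J_def)
    have "incl i x \<in> summand j" using ij x i incl_in_summand by blast
    then show "i = j" using x i by (auto simp: summand_def)
  qed
  interpret E: module_family R SS "\<lambda>S. D\<lparr>carrier := S\<rparr>"
  proof (rule module_family.intro)
    show "cring R" by (rule cring)
    show "module R (D\<lparr>carrier := S\<rparr>)" if "S \<in> SS" for S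
      using that submodule.submodule_is_module[OF submodule_summand module_direct_sum]
      by (auto simp: SS_def)
  qed
  have mem: "f (summand i) \<in> summand i" if "f \<in> carrier ?E" "i \<in> J" for f i
  proof -
    have "summand i \<in> SS" using that by (simp add: SS_def)
    then show ?thesis using that by (simp add: E.carrier_direct_sum)
  qed
  have fin: "finite {S \<in> SS. f S \<noteq> \<zero>\<^bsub>D\<^esub>}" if "f \<in> carrier ?E" for f
    using that by (simp add: E.carrier_direct_sum)
  have memD: "f \<in> {S \<in> SS. f S \<noteq> \<zero>\<^bsub>D\<^esub>} \<rightarrow> carrier D" if "f \<in> carrier ?E" for f
  proof
    fix S assume "S \<in> {S \<in> SS. f S \<noteq> \<zero>\<^bsub>D\<^esub>}"
    then obtain i where "i \<in> J" "S = summand i" by (auto simp: SS_def)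
    then show "f S \<in> carrier D" using mem[OF that] by (auto simp: summand_def)
  qed
  have closed: "?\<Phi> f \<in> carrier D" if "f \<in> carrier ?E" for f
    using memD[OF that] by (rule D.finsum_closed)
  \<comment> \<open>the coordinate at \<open>i\<close> of the sum is that of the single term from \<open>summand i\<close>\<close>
  have coord: "?\<Phi> f i = f (summand i) i" if f: "f \<in> carrier ?E" and i: "i \<in> J" for f i
  proof -
    let ?A = "{S \<in> SS. f S \<noteq> \<zero>\<^bsub>D\<^esub>}"
    have iI: "i \<in> I" using i JI by auto
    interpret Mi: abelian_monoid "M i" by (rule abelian_monoid_component[OF iI])
    have fi: "f (summand i) \<in> summand i" by (rule mem[OF f i])
    have "?\<Phi> f i = (\<Oplus>\<^bsub>M i\<^esub>S\<in>?A. f S i)"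
      by (rule finsum_direct_sum_apply[OF fin[OF f] memD[OF f] iI])
    also have "\<dots> = (\<Oplus>\<^bsub>M i\<^esub>S\<in>?A. if summand i = S then f S i else \<zero>\<^bsub>M i\<^esub>)"
    proof (rule Mi.finsum_cong')
      show "(\<lambda>S. if summand i = S then f S i else \<zero>\<^bsub>M i\<^esub>) \<in> ?A \<rightarrow> carrier (M i)"
        using memD[OF f] iI by (auto simp: carrier_direct_sum Pi_iff)
      fix S assume "S \<in> ?A"
      then obtain j where j: "j \<in> J" "S = summand j" by (auto simp: SS_def)
      show "f S i = (if summand i = S then f S i else \<zero>\<^bsub>M i\<^esub>)"
        using mem[OF f j(1)] iI j(2) by (cases "i = j") (auto simp: summand_def)
    qed simp
    also have "\<dots> = f (summand i) i"
    proof (cases "f (summand i) = \<zero>\<^bsub>D\<^esub>")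
      case True
      then have "(\<Oplus>\<^bsub>M i\<^esub>S\<in>?A. if summand i = S then f S i else \<zero>\<^bsub>M i\<^esub>) = (\<Oplus>\<^bsub>M i\<^esub>S\<in>?A. \<zero>\<^bsub>M i\<^esub>)"
        by (intro Mi.finsum_cong') auto
      with True iI show ?thesis by (simp add: direct_sum_apply)
    next
      case False
      show ?thesis
      proof (rule Mi.finsum_singleton)
        show "summand i \<in> ?A" using False i by (simp add: SS_def)
        show "finite ?A" by (rule fin[OF f])
        show "(\<lambda>S. f S i) \<in> ?A \<rightarrow> carrier (M i)"
          using memD[OF f] iI by (auto simp: carrier_direct_sum Pi_iff)
      qed
    qed
    finally show ?thesis .
  qed
  have "bij_betw ?\<Phi> (carrier ?E) (carrier D)"
  proof (rule bij_betwI')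
    fix f g assume f: "f \<in> carrier ?E" and g: "g \<in> carrier ?E"
    show "?\<Phi> f = ?\<Phi> g \<longleftrightarrow> f = g"
    proof
      assume eq: "?\<Phi> f = ?\<Phi> g"
      show "f = g"
      proof (rule E.direct_sum_eqI)
        show "f \<in> extensional SS" "g \<in> extensional SS"
          using f g by (simp_all add: E.carrier_direct_sum)
        fix S assume "S \<in> SS"
        then obtain i where i: "i \<in> J" "S = summand i" by (auto simp: SS_def)
        have "f S i = g S i" using coord[OF f i(1)] coord[OF g i(1)] eq i(2) by simp
        then show "f S = g S"
          using mem[OF f i(1)] mem[OF g i(1)] incl_component i(2) by metis
      qed
    qed simp
  next
    fix f assume "f \<in> carrier ?E"
    then show "?\<Phi> f \<in> carrier D" by (rule closed)
  next
    fix g assume g: "g \<in> carrier D"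
    define f where "f = (\<lambda>S\<in>SS. incl (inv_into J summand S) (g (inv_into J summand S)))"
    have f_summand: "f (summand i) = incl i (g i)" if "i \<in> J" for i
      using that by (simp add: f_def SS_def inv_into_f_f[OF inj])
    have gi: "incl i (g i) \<in> summand i" if "i \<in> J" for i
      using that JI g by (intro incl_in_summand) (auto simp: carrier_direct_sum)
    have "{S \<in> SS. f S \<noteq> \<zero>\<^bsub>D\<^esub>} \<subseteq> summand ` {i \<in> I. g i \<noteq> \<zero>\<^bsub>M i\<^esub>}"
      using f_summand incl_zero JI by (fastforce simp: SS_def)
    then have "finite {S \<in> SS. f S \<noteq> \<zero>\<^bsub>D\<^esub>}"
      by (rule finite_subset) (use g in \<open>simp add: carrier_direct_sum\<close>)
    then have f: "f \<in> carrier ?E"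
      unfolding E.carrier_direct_sum using f_summand gi by (auto simp: SS_def f_def)
    have "?\<Phi> f = g"
    proof (rule direct_sum_eqI)
      show "?\<Phi> f \<in> extensional I" using closed[OF f] by (simp only: carrier_direct_sum)
      show "g \<in> extensional I" using g by (simp add: carrier_direct_sum)
      fix i assume i: "i \<in> I"
      show "?\<Phi> f i = g i"
      proof (cases "i \<in> J")
        case True
        then show ?thesis unfolding coord[OF f True] f_summand[OF True] using i by simp
      next
        case False
        then have "carrier (M i) = {\<zero>\<^bsub>M i\<^esub>}" using i by (simp add: J_def)
        moreover have "?\<Phi> f i \<in> carrier (M i)" "g i \<in> carrier (M i)"
          using closed[OF f] g i by (simp_all only: carrier_direct_sum)
        ultimately have "?\<Phi> f i = \<zero>\<^bsub>M i\<^esub>" "g i = \<zero>\<^bsub>M i\<^esub>" by (simp_all only: singleton_iff)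
        then show ?thesis by (rule trans[OF _ sym])
      qed
    qed
    then show "\<exists>f\<in>carrier ?E. g = ?\<Phi> f" by (rule bexI[OF sym f])
  qed
  moreover have "\<forall>S\<in>SS. submodule S R D \<and> simple_module R (D\<lparr>carrier := S\<rparr>)"
  proof
    fix S assume "S \<in> SS"
    then obtain i where i: "i \<in> I" "carrier (M i) \<noteq> {\<zero>\<^bsub>M i\<^esub>}" "S = summand i"
      by (auto simp: SS_def J_def)
    then show "submodule S R D \<and> simple_module R (D\<lparr>carrier := S\<rparr>)"
      using submodule_summand simple_summand[OF i(1) simple[OF i(1,2)]] by simp
  qed
  ultimately show ?thesis
    unfolding semisimple_module_def by (intro conjI module_direct_sum exI[of _ SS])
qed

lemma faithful_direct_sum:
  assumes "\<And>r. r \<in> carrier R \<Longrightarrow> (\<And>i x. i \<in> I \<Longrightarrow> x \<in> carrier (M i) \<Longrightarrow> r \<odot>\<^bsub>M i\<^esub> x = \<zero>\<^bsub>M i\<^esub>) \<Longrightarrow> r = \<zero>\<^bsub>R\<^esub>"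
  shows "faithful_module R D"
  unfolding faithful_module_def
proof (intro conjI ballI impI)
  show "module R D" by (rule module_direct_sum)
  fix r assume r: "r \<in> carrier R" and zero: "\<forall>f\<in>carrier D. r \<odot>\<^bsub>D\<^esub> f = \<zero>\<^bsub>D\<^esub>"
  show "r = \<zero>\<^bsub>R\<^esub>"
  proof (rule assms[OF r])
    fix i x assume i: "i \<in> I" "x \<in> carrier (M i)"
    then have "incl i x \<in> carrier D" using incl_in_summand[OF i] by (simp add: summand_def)
    then have "(r \<odot>\<^bsub>D\<^esub> incl i x) i = \<zero>\<^bsub>D\<^esub> i" using zero by simp
    then show "r \<odot>\<^bsub>M i\<^esub> x = \<zero>\<^bsub>M i\<^esub>" using i(1) by (simp add: direct_sum_apply)
  qed
qed

end

section \<open>Quotients of a commutative ring as modules\<close>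

lemma carrier_quotient_module:
  "C \<in> carrier (quotient_module R I) \<longleftrightarrow> (\<exists>a\<in>carrier R. C = I +>\<^bsub>R\<^esub> a)"
  unfolding quotient_module_def FactRing_def A_RCOSETS_def' by auto

lemma zero_quotient_module: "\<zero>\<^bsub>quotient_module R I\<^esub> = I"
  by (simp add: quotient_module_def FactRing_def)

lemma abelian_group_quotient_module:
  assumes "ideal I R"
  shows "abelian_group (quotient_module R I)"
proof -
  interpret ideal I R by fact
  interpret Q: ring "R Quot I" by (rule quotient_is_ring)
  show ?thesis
    by (rule abelian_groupI)
      (simp_all add: quotient_module_def Q.a_assoc Q.a_comm Q.a_lcomm)
qed

lemma module_quotient_module:
  assumes "cring R" "ideal I R"
  shows "module R (quotient_module R I)"
proof -
  interpret ideal I R by fact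
  interpret Q: cring "R Quot I" by (rule quotient_is_cring[OF assms(1)])
  interpret h: ring_hom_ring R "R Quot I" "(+>\<^bsub>R\<^esub>) I" by (rule rcos_ring_hom_ring)
  show ?thesis
    by (rule moduleI[OF assms(1) abelian_group_quotient_module[OF assms(2)]])
      (auto simp: quotient_module_def Q.l_distr Q.r_distr Q.m_assoc)
qed

text \<open>
  The preimage in \<open>R\<close> of a submodule of the quotient is an ideal containing \<open>I\<close>, so maximality of
  \<open>I\<close> leaves two possibilities.
\<close>

lemma simple_quotient_module:
  assumes R: "cring R" and "maximalideal I R"
  shows "simple_module R (quotient_module R I)"
  unfolding simple_module_def
proof (intro conjI allI impI)
  let ?Q = "quotient_module R I"
  interpret maximalideal I R by fact
  interpret R: cring R by fact
  interpret h: ring_hom_ring R "R Quot I" "(+>\<^bsub>R\<^esub>) I" by (rule rcos_ring_hom_ring)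
  show "module R ?Q" by (rule module_quotient_module[OF R is_ideal])
  then interpret Q: module R ?Q .
  have carr: "C \<in> carrier ?Q \<longleftrightarrow> (\<exists>a\<in>carrier R. C = I +>\<^bsub>R\<^esub> a)" for C
    by (rule carrier_quotient_module)
  have zero: "\<zero>\<^bsub>?Q\<^esub> = I" by (rule zero_quotient_module)
  have coset_I: "I +>\<^bsub>R\<^esub> a = I \<longleftrightarrow> a \<in> I" if "a \<in> carrier R" for a
    using that a_rcos_self[of a] a_rcos_const[of a] by auto
  show "carrier ?Q \<noteq> {\<zero>\<^bsub>?Q\<^esub>}"
  proof
    assume "carrier ?Q = {\<zero>\<^bsub>?Q\<^esub>}"
    then have "I +>\<^bsub>R\<^esub> \<one>\<^bsub>R\<^esub> = I" using carr zero by (metis one_closed singletonD)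
    then have "\<one>\<^bsub>R\<^esub> \<in> I" using coset_I[OF one_closed] by blast
    then show False using one_imp_carrier I_notcarr by blast
  qed
  fix N assume N: "submodule N R ?Q"
  define J where "J = {a \<in> carrier R. I +>\<^bsub>R\<^esub> a \<in> N}"
  have N0: "I \<in> N"
    using subgroup.one_closed[OF submodule.axioms(1)[OF N]] zero by simp
  have mult: "x \<otimes>\<^bsub>R\<^esub> a \<in> J" if "a \<in> J" "x \<in> carrier R" for a x
    using Q.submoduleE(4)[OF N, of x "I +>\<^bsub>R\<^esub> a"] that
    by (simp add: J_def quotient_module_def)
  have J: "ideal J R"
  proof (rule idealI)
    show "ring R" by (rule ring_axioms)
    fix a x assume ax: "a \<in> J" "x \<in> carrier R"
    then show "x \<otimes>\<^bsub>R\<^esub> a \<in> J" by (rule mult)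
    moreover have "a \<otimes>\<^bsub>R\<^esub> x = x \<otimes>\<^bsub>R\<^esub> a" using ax by (simp add: J_def R.m_comm)
    ultimately show "a \<otimes>\<^bsub>R\<^esub> x \<in> J" by simp
  next
    show "subgroup J (add_monoid R)"
    proof (rule add.subgroupI)
      show "J \<noteq> {}" using N0 coset_I[of "\<zero>\<^bsub>R\<^esub>"] by (auto simp: J_def)
      show "\<ominus>\<^bsub>R\<^esub> a \<in> J" if "a \<in> J" for a
        using mult[OF that, of "\<ominus>\<^bsub>R\<^esub> \<one>\<^bsub>R\<^esub>"] that by (simp add: J_def l_minus)
      show "a \<oplus>\<^bsub>R\<^esub> b \<in> J" if "a \<in> J" "b \<in> J" for a b
        using Q.submoduleE(5)[OF N, of "I +>\<^bsub>R\<^esub> a" "I +>\<^bsub>R\<^esub> b"] that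
        by (simp add: J_def quotient_module_def)
    qed (auto simp: J_def)
  qed
  have "I \<subseteq> J" using N0 by (auto simp: J_def a_Hcarr a_rcos_const)
  moreover have "J \<subseteq> carrier R" by (auto simp: J_def)
  ultimately have "J = I \<or> J = carrier R" using I_maximal[OF J] by blast
  moreover have NJ: "N = (\<lambda>a. I +>\<^bsub>R\<^esub> a) ` J"
  proof (rule Set.set_eqI)
    fix C
    have "C \<in> N \<Longrightarrow> \<exists>a\<in>carrier R. C = I +>\<^bsub>R\<^esub> a"
      using Q.submoduleE(1)[OF N] carr[of C] by blast
    then show "C \<in> N \<longleftrightarrow> C \<in> (\<lambda>a. I +>\<^bsub>R\<^esub> a) ` J" by (force simp: J_def)
  qed
  ultimately show "N = {\<zero>\<^bsub>?Q\<^esub>} \<or> N = carrier ?Q"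
  proof (elim disjE)
    assume "J = I"
    then have "N \<subseteq> {I}" using NJ a_rcos_const by blast
    then have "N = {\<zero>\<^bsub>?Q\<^esub>}" using N0 zero by auto
    then show ?thesis ..
  next
    assume "J = carrier R"
    then have "N = carrier ?Q" using NJ carr by (intro Set.set_eqI) (simp add: image_iff)
    then show ?thesis ..
  qed
qed

text \<open>
  Look at the action on the class of \<open>1\<close>.
\<close>

lemma annihilator_quotient_module:
  assumes "ideal I R" "r \<in> carrier R"
    and annihilates: "\<And>C. C \<in> carrier (quotient_module R I) \<Longrightarrow>
      r \<odot>\<^bsub>quotient_module R I\<^esub> C = \<zero>\<^bsub>quotient_module R I\<^esub>"
  shows "r \<in> I"
proof -
  interpret ideal I R by fact
  have "I +>\<^bsub>R\<^esub> \<one>\<^bsub>R\<^esub> \<in> carrier (quotient_module R I)"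
    unfolding carrier_quotient_module by blast
  from annihilates[OF this] have "rcoset_mult R I (I +>\<^bsub>R\<^esub> r) (I +>\<^bsub>R\<^esub> \<one>\<^bsub>R\<^esub>) = I"
    unfolding zero_quotient_module by (simp add: quotient_module_def FactRing_def)
  then have "I +>\<^bsub>R\<^esub> r = I"
    unfolding rcoset_mult_add[OF assms(2) one_closed] using assms(2) by simp
  then show "r \<in> I" using a_rcos_self[OF assms(2)] by simp
qed

section \<open>Monoid algebras and their characters\<close>

lemma cring_monoid_algebra:
  fixes S :: "'m::comm_monoid_add set"
  assumes "0 \<in> S" "\<And>a b. a \<in> S \<Longrightarrow> b \<in> S \<Longrightarrow> a + b \<in> S"
  shows "cring (monoid_algebra S :: ('m \<Rightarrow>\<^sub>0 'k::comm_ring_1) ring)"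
proof (rule cringI)
  let ?A = "monoid_algebra S :: ('m \<Rightarrow>\<^sub>0 'k) ring"
  have keys_add_subset: "Poly_Mapping.keys (f + g) \<subseteq> S"
    if "Poly_Mapping.keys f \<subseteq> S" "Poly_Mapping.keys g \<subseteq> S" for f g :: "'m \<Rightarrow>\<^sub>0 'k"
    using that Poly_Mapping.keys_add[of f g] by blast
  have keys_mult_subset: "Poly_Mapping.keys (f * g) \<subseteq> S"
    if "Poly_Mapping.keys f \<subseteq> S" "Poly_Mapping.keys g \<subseteq> S" for f g :: "'m \<Rightarrow>\<^sub>0 'k"
  proof
    fix x assume "x \<in> Poly_Mapping.keys (f * g)"
    then obtain a b where "x = a + b" "a \<in> Poly_Mapping.keys f" "b \<in> Poly_Mapping.keys g"
      using Poly_Mapping.keys_mult[of f g] by blast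
    then show "x \<in> S" using that assms(2) by blast
  qed
  show "abelian_group ?A"
  proof (rule abelian_groupI)
    fix f assume f: "f \<in> carrier ?A"
    have "Poly_Mapping.keys (- f) = Poly_Mapping.keys f"
      by (auto simp: in_keys_iff)
    with f show "\<exists>g\<in>carrier ?A. g \<oplus>\<^bsub>?A\<^esub> f = \<zero>\<^bsub>?A\<^esub>"
      by (intro bexI[of _ "- f"]) (simp_all add: monoid_algebra_def)
  qed (use keys_add_subset in \<open>simp_all add: monoid_algebra_def algebra_simps\<close>)
  show "comm_monoid ?A"
    by (rule comm_monoidI)
      (use keys_mult_subset assms(1) in \<open>simp_all add: monoid_algebra_def algebra_simps\<close>)
qed (simp add: monoid_algebra_def algebra_simps)

text \<open>
  The linear extension to the monoid algebra of a function \<open>\<chi>\<close> on the monoid; a ring homomorphism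
  when \<open>\<chi>\<close> is a character.
\<close>

definition eval_at :: "('m \<Rightarrow> 'k::comm_ring_1) \<Rightarrow> ('m \<Rightarrow>\<^sub>0 'k) \<Rightarrow> 'k" where
  "eval_at \<chi> f = (\<Sum>s\<in>Poly_Mapping.keys f. Poly_Mapping.lookup f s * \<chi> s)"

lemma eval_at_superset:
  assumes "finite A" "Poly_Mapping.keys f \<subseteq> A"
  shows "eval_at \<chi> f = (\<Sum>s\<in>A. Poly_Mapping.lookup f s * \<chi> s)"
  unfolding eval_at_def using assms by (intro sum.mono_neutral_left) (auto simp: in_keys_iff)

lemma eval_at_0 [simp]: "eval_at \<chi> 0 = 0"
  by (simp add: eval_at_def)

lemma eval_at_add: "eval_at \<chi> (f + g) = eval_at \<chi> f + eval_at \<chi> g"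
proof -
  let ?A = "Poly_Mapping.keys f \<union> Poly_Mapping.keys g"
  have "Poly_Mapping.keys (f + g) \<subseteq> ?A" by (rule Poly_Mapping.keys_add)
  then show ?thesis
    by (simp add: eval_at_superset[of ?A] lookup_add algebra_simps sum.distrib)
qed

lemma eval_at_uminus: "eval_at \<chi> (- f) = - eval_at \<chi> f"
  using eval_at_add[of \<chi> "- f" f] by (simp add: eq_neg_iff_add_eq_0)

lemma eval_at_diff: "eval_at \<chi> (f - g) = eval_at \<chi> f - eval_at \<chi> g"
  using eval_at_add[of \<chi> f "- g"] by (simp add: eval_at_uminus)

lemma eval_at_sum: "eval_at \<chi> (\<Sum>a\<in>A. f a) = (\<Sum>a\<in>A. eval_at \<chi> (f a))"
  by (induction A rule: infinite_finite_induct) (simp_all add: eval_at_add)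

lemma eval_at_single [simp]: "eval_at \<chi> (Poly_Mapping.single s c) = c * \<chi> s"
  by (simp add: eval_at_superset[of "{s}"])

lemma sum_single_lookup:
  "(\<Sum>s\<in>Poly_Mapping.keys f. Poly_Mapping.single s (Poly_Mapping.lookup f s)) = f"
proof (rule poly_mapping_eqI)
  fix x
  have "(\<Sum>s\<in>Poly_Mapping.keys f. Poly_Mapping.lookup f s when s = x) = Poly_Mapping.lookup f x"
  proof (cases "x \<in> Poly_Mapping.keys f")
    case True
    then show ?thesis by (simp add: when_def sum.delta)
  next
    case False
    then show ?thesis by (subst sum.neutral) (auto simp: when_def in_keys_iff)
  qed
  then show "Poly_Mapping.lookup (\<Sum>s\<in>Poly_Mapping.keys f. Poly_Mapping.single s (Poly_Mapping.lookup f s)) x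
      = Poly_Mapping.lookup f x"
    by (simp add: lookup_sum lookup_single)
qed

lemma eval_at_mult:
  fixes f g :: "'m::comm_monoid_add \<Rightarrow>\<^sub>0 'k::comm_ring_1"
  assumes "\<And>a b. \<chi> (a + b) = \<chi> a * \<chi> b"
  shows "eval_at \<chi> (f * g) = eval_at \<chi> f * eval_at \<chi> g"
proof -
  let ?f = "\<lambda>s. Poly_Mapping.single s (Poly_Mapping.lookup f s)"
  let ?g = "\<lambda>s. Poly_Mapping.single s (Poly_Mapping.lookup g s)"
  have "f * g = (\<Sum>a\<in>Poly_Mapping.keys f. ?f a) * (\<Sum>b\<in>Poly_Mapping.keys g. ?g b)"
    by (simp only: sum_single_lookup)
  also have "\<dots> = (\<Sum>a\<in>Poly_Mapping.keys f. \<Sum>b\<in>Poly_Mapping.keys g.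
      Poly_Mapping.single (a + b) (Poly_Mapping.lookup f a * Poly_Mapping.lookup g b))"
    by (simp add: sum_product mult_single)
  finally show ?thesis
    by (simp add: eval_at_sum assms) (simp add: eval_at_def sum_product algebra_simps)
qed

lemma ideal_kernel_eval_at:
  fixes S :: "'m::comm_monoid_add set" and \<chi> :: "'m \<Rightarrow> 'k::comm_ring_1"
  assumes "0 \<in> S" "\<And>a b. a \<in> S \<Longrightarrow> b \<in> S \<Longrightarrow> a + b \<in> S"
    and \<chi>: "\<And>a b. \<chi> (a + b) = \<chi> a * \<chi> b"
  shows "ideal {f \<in> carrier (monoid_algebra S). eval_at \<chi> f = 0} (monoid_algebra S)"
proof -
  let ?A = "monoid_algebra S :: ('m \<Rightarrow>\<^sub>0 'k) ring"
  interpret cring ?A by (rule cring_monoid_algebra[OF assms(1,2)])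
  have mult: "eval_at \<chi> (x \<otimes>\<^bsub>?A\<^esub> y) = eval_at \<chi> x * eval_at \<chi> y" for x y
    by (simp add: monoid_algebra_def eval_at_mult[OF \<chi>])
  have add: "eval_at \<chi> (x \<oplus>\<^bsub>?A\<^esub> y) = eval_at \<chi> x + eval_at \<chi> y" for x y
    by (simp add: monoid_algebra_def eval_at_add)
  have zero: "eval_at \<chi> \<zero>\<^bsub>?A\<^esub> = 0" by (simp add: monoid_algebra_def)
  show ?thesis
  proof (rule idealI)
    show "ring ?A" by (rule ring_axioms)
    show "subgroup {f \<in> carrier ?A. eval_at \<chi> f = 0} (add_monoid ?A)"
    proof (rule add.subgroupI)
      show "{f \<in> carrier ?A. eval_at \<chi> f = 0} \<noteq> {}" using zero zero_closed by blast
      fix f assume f: "f \<in> {f \<in> carrier ?A. eval_at \<chi> f = 0}"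
      then have "eval_at \<chi> (\<ominus>\<^bsub>?A\<^esub> f \<oplus>\<^bsub>?A\<^esub> f) = 0" using zero by (simp add: l_neg)
      then show "\<ominus>\<^bsub>?A\<^esub> f \<in> {f \<in> carrier ?A. eval_at \<chi> f = 0}" using f by (simp add: add)
    qed (auto simp: add)
  qed (auto simp: mult)
qed

text \<open>
  The Vandermonde argument: the vanishing of the power sums extends by linearity to
  \<open>\<Sum>a. c a * poly p (v a) = 0\<close> for every polynomial \<open>p\<close>, and the Lagrange
  polynomial that vanishes at all nodes but \<open>v a\<close> isolates \<open>c a\<close>.
\<close>

lemma separate_by_powers:
  fixes v :: "'a \<Rightarrow> 'k::field" and c :: "'a \<Rightarrow> 'k"
  assumes A: "finite A" "inj_on v A" and zero: "\<And>k. (\<Sum>a\<in>A. c a * v a ^ k) = 0" and a: "a \<in> A"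
  shows "c a = 0"
proof -
  have poly_zero: "(\<Sum>a\<in>A. c a * poly p (v a)) = 0" for p
  proof -
    have "(\<Sum>a\<in>A. c a * poly p (v a)) = (\<Sum>k\<le>degree p. coeff p k * (\<Sum>a\<in>A. c a * v a ^ k))"
      by (simp add: poly_altdef sum_distrib_left mult_ac) (rule sum.swap)
    then show ?thesis by (simp add: zero)
  qed
  define p where "p = (\<Prod>b\<in>A - {a}. [:- v b, 1:])"
  have "poly p (v b) = 0" if "b \<in> A - {a}" for b
    using that A(1) by (auto simp: p_def poly_prod)
  then have "(\<Sum>b\<in>A. c b * poly p (v b)) = c a * poly p (v a)"
    using A(1) a by (subst sum.remove[of _ a]) auto
  moreover have "poly p (v a) \<noteq> 0"
    using A a by (auto simp: p_def poly_prod dest: inj_onD)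
  ultimately show ?thesis using poly_zero[of p] by simp
qed

section \<open>Rows of tableaux and the star product\<close>

text \<open>
  Indexing by all row numbers, with empty multisets past the last row, turns \<open>\<star>\<close> into plain
  addition in every row.
\<close>

definition row_mset :: "ssyt \<Rightarrow> nat \<Rightarrow> nat multiset" where
  "row_mset T i = (if i < length (rows T) then mset (rows T ! i) else {#})"

lemma row_mset_add: "row_mset (S + T) i = row_mset S i + row_mset T i"
proof -
  have "(if i < length (star_rows rs ss) then mset (star_rows rs ss ! i) else {#}) =
      (if i < length rs then mset (rs ! i) else {#}) + (if i < length ss then mset (ss ! i) else {#})"
    for rs ss
  proof (induction rs ss arbitrary: i rule: star_rows.induct)
    case (3 r rs s ss)
    show ?case
    proof (cases i)
      case (Suc j)
      then show ?thesis using 3[of j] by (auto split: if_splits)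
    qed simp
  qed auto
  then show ?thesis unfolding row_mset_def plus_ssyt.rep_eq .
qed

lemma row_mset_0 [simp]: "row_mset 0 i = {#}"
  by (simp add: row_mset_def zero_ssyt.rep_eq)

lemma is_ssyt_rows: "is_ssyt (rows T)"
  using rows by simp

lemma ssyt_eqI_row_mset:
  assumes "length (rows S) \<le> n" "length (rows T) \<le> n"
    and "\<And>i. i < n \<Longrightarrow> row_mset S i = row_mset T i"
  shows "S = T"
proof -
  have ne: "row_mset U i = {#} \<longleftrightarrow> length (rows U) \<le> i" for U i
    using is_ssyt_rows[of U] by (auto simp: row_mset_def is_ssyt_def dest!: nth_mem)
  have len: "length (rows S) = length (rows T)"
  proof (rule ccontr)
    assume "length (rows S) \<noteq> length (rows T)"
    then have "min (length (rows S)) (length (rows T)) < n"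
      "(length (rows S) \<le> min (length (rows S)) (length (rows T)))
        \<noteq> (length (rows T) \<le> min (length (rows S)) (length (rows T)))"
      using assms(1,2) by auto
    then show False using assms(3) ne by metis
  qed
  have "rows S = rows T"
  proof (rule nth_equalityI[OF len])
    fix i assume i: "i < length (rows S)"
    then have "mset (rows S ! i) = mset (rows T ! i)"
      using assms(1) assms(3)[of i] len by (simp add: row_mset_def)
    moreover have "sorted (rows S ! i)" "sorted (rows T ! i)"
      using i len is_ssyt_rows[of S] is_ssyt_rows[of T] by (auto simp: is_ssyt_def)
    ultimately show "rows S ! i = rows T ! i"
      by (metis sorted_list_of_multiset_mset sorted_sort_id)
  qed
  then show ?thesis by (simp add: rows_inject)
qed

lemma zero_in_SSYT: "0 \<in> SSYT n m"
  by (simp add: SSYT_def zero_ssyt.rep_eq)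

lemma add_in_SSYT:
  assumes "S \<in> SSYT n m" "T \<in> SSYT n m"
  shows "S + T \<in> SSYT n m"
proof -
  have "length (star_rows rs ss) = max (length rs) (length ss)" for rs ss
    by (induction rs ss rule: star_rows.induct) auto
  then have "length (rows (S + T)) \<le> n"
    using assms by (simp add: SSYT_def plus_ssyt.rep_eq)
  moreover have rows_subset: "\<forall>r\<in>set (star_rows rs ss). set r \<subseteq> Y"
    if "\<forall>r\<in>set rs. set r \<subseteq> Y" "\<forall>r\<in>set ss. set r \<subseteq> Y" for rs ss Y
    using that by (induction rs ss rule: star_rows.induct) (auto dest: subsetD)
  have "\<forall>r\<in>set (rows (S + T)). set r \<subseteq> {1..m}"
    unfolding plus_ssyt.rep_eq by (rule rows_subset) (use assms in \<open>unfold SSYT_def, blast+\<close>)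
  ultimately show ?thesis unfolding SSYT_def by blast
qed

section \<open>Tableaux are products of columns\<close>

lemma first_row_longest: "is_ssyt (r # rs) \<Longrightarrow> s \<in> set rs \<Longrightarrow> length s \<le> length r"
  by (auto simp: is_ssyt_def)

lemma row_singleton:
  assumes "is_ssyt (r # rs)" "tl r = []" "s \<in> set rs"
  shows "tl s = []" "[hd s] = s"
proof -
  have "length s \<le> 1"
    using first_row_longest[OF assms(1,3)] assms(2) by (cases r) auto
  moreover have "s \<noteq> []" using assms(1,3) by (auto simp: is_ssyt_def)
  ultimately show "tl s = []" "[hd s] = s" by (cases s; simp)+
qed

text \<open>
  A tableau is taken apart into its first column and the tableau formed by the remaining columns,
  from which the rows that became empty are dropped. Row lengths weakly decrease, so the dropped
  rows are the last ones and the others keep their index.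
\<close>

definition first_column :: "nat list list \<Rightarrow> nat list list" where
  "first_column rs = map (\<lambda>r. [hd r]) rs"

definition other_columns :: "nat list list \<Rightarrow> nat list list" where
  "other_columns rs = filter (\<lambda>r. r \<noteq> []) (map tl rs)"

lemma other_columns_singleton:
  assumes "is_ssyt (r # rs)" "tl r = []"
  shows "other_columns rs = []"
proof -
  have "\<forall>s\<in>set rs. tl s = []" using row_singleton(1)[OF assms] by blast
  then show ?thesis by (simp add: other_columns_def filter_empty_conv)
qed

lemma star_first_column: "is_ssyt rs \<Longrightarrow> star_rows (first_column rs) (other_columns rs) = rs"
proof (induction rs)
  case Nil
  then show ?case by (simp add: first_column_def other_columns_def)
next
  case (Cons r rs)
  have r: "r \<noteq> []" "sorted r" "is_ssyt rs" using Cons.prems by (auto simp: is_ssyt_Cons)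
  show ?case
  proof (cases "tl r = []")
    case True
    have "first_column rs = rs"
      unfolding first_column_def by (rule map_idI) (rule row_singleton(2)[OF Cons.prems True])
    moreover have "other_columns (r # rs) = []"
      using True other_columns_singleton[OF Cons.prems True] by (simp add: other_columns_def)
    moreover have "[hd r] = r" using r(1) True by (cases r) auto
    ultimately show ?thesis by (simp add: first_column_def)
  next
    case False
    have "sort ([hd r] @ tl r) = r" using r by (simp add: sorted_sort_id del: sort_key_simps)
    then show ?thesis
      using False Cons.IH[OF r(3)] by (simp add: first_column_def other_columns_def del: sort_key_simps)
  qed
qed

lemma is_ssyt_first_column: "is_ssyt rs \<Longrightarrow> is_ssyt (first_column rs)"
proof (induction rs)
  case Nil
  then show ?case by (simp add: first_column_def is_ssyt_Nil)
next
  case (Cons r rs)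
  have "fits_below [hd r] (hd_row (first_column rs))"
  proof (cases rs)
    case (Cons s ss)
    then have "is_ssyt (r # s # ss)" using Cons.prems by simp
    then have "fits_below r s" "sorted r" "sorted s" "r \<noteq> []" "s \<noteq> []"
      by (simp_all add: is_ssyt_Cons)
    then have "hd r < hd s" by (simp add: fits_below_iff hd_conv_nth)
    then show ?thesis using Cons by (simp add: first_column_def fits_below_iff)
  qed (simp add: first_column_def)
  then show ?case using Cons by (auto simp: is_ssyt_Cons first_column_def)
qed

lemma is_ssyt_other_columns: "is_ssyt rs \<Longrightarrow> is_ssyt (other_columns rs)"
proof (induction rs)
  case Nil
  then show ?case by (simp add: other_columns_def is_ssyt_Nil)
next
  case (Cons r rs)
  have r: "r \<noteq> []" "sorted r" "is_ssyt rs" "\<forall>x\<in>set r. 0 < x"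
    using Cons.prems by (auto simp: is_ssyt_Cons)
  show ?case
  proof (cases "tl r = []")
    case True
    then show ?thesis
      using other_columns_singleton[OF Cons.prems True] by (simp add: other_columns_def is_ssyt_Nil)
  next
    case False
    have "fits_below (tl r) (hd_row (other_columns rs))"
    proof (cases rs)
      case Nil
      then show ?thesis by (simp add: other_columns_def)
    next
      case (Cons s ss)
      have s: "fits_below r s" "sorted s"
        using Cons.prems Cons by (simp_all add: is_ssyt_Cons)
      show ?thesis
      proof (cases "tl s = []")
        case True
        then show ?thesis
          using other_columns_singleton[of s ss] r(3) Cons by (simp add: other_columns_def)
      next
        case False
        have "fits_below (tl r) (tl s)"
          using s r(2) by (auto simp: fits_below_iff sorted_tl nth_tl)
        then show ?thesis using False Cons by (simp add: other_columns_def)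
      qed
    qed
    moreover have "\<forall>x\<in>set (tl r). 0 < x" using r by (cases r) auto
    ultimately show ?thesis
      using False r Cons.IH by (simp add: other_columns_def is_ssyt_Cons sorted_tl)
  qed
qed

text \<open>
  The length of the first row drops by one, which serves as the measure for inductions on
  the number of columns.
\<close>

lemma split_first_column:
  assumes "T \<in> SSYT n m" "T \<noteq> 0"
  obtains C T' where "C \<in> G_set n m" "T' \<in> SSYT n m" "T = C + T'"
    "length (hd_row (rows T')) < length (hd_row (rows T))"
proof -
  define C where "C = Abs_ssyt (first_column (rows T))"
  define T' where "T' = Abs_ssyt (other_columns (rows T))"
  have rows: "rows C = first_column (rows T)" "rows T' = other_columns (rows T)"
    unfolding C_def T'_def
    by (simp_all add: Abs_ssyt_inverse is_ssyt_first_column is_ssyt_other_columns is_ssyt_rows)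
  have sum: "T = C + T'"
    by (simp add: plus_ssyt.rep_eq rows star_first_column is_ssyt_rows flip: rows_inject)
  obtain r rs where T: "rows T = r # rs"
    using assms(2) by (cases "rows T") (auto simp: zero_ssyt.rep_eq simp flip: rows_inject)
  have ssyt: "is_ssyt (r # rs)" using is_ssyt_rows[of T] T by simp
  have ne: "\<forall>s\<in>set (rows T). s \<noteq> []" using is_ssyt_rows[of T] by (auto simp: is_ssyt_def)
  have sub: "\<forall>s\<in>set (rows T). set s \<subseteq> {1..m}" and len: "length (rows T) \<le> n"
    using assms(1) by (auto simp: SSYT_def)
  have "set [hd s] \<subseteq> {1..m}" if "s \<in> set (rows T)" for s
    using sub ne that hd_in_set[of s] by (metis empty_set insert_subset list.simps(15) subset_eq empty_subsetI)
  then have "C \<in> G_set n m"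
    using T len by (auto simp: G_set_def SSYT_def rows first_column_def simp del: One_nat_def)
  moreover have "set (tl s) \<subseteq> {1..m}" if "s \<in> set (rows T)" for s
    using sub ne that list.set_sel(2)[of s] by blast
  then have "T' \<in> SSYT n m"
    using len by (auto simp: SSYT_def rows other_columns_def simp del: One_nat_def
        intro: order_trans[OF length_filter_le])
  moreover have "length (hd_row (rows T')) < length (hd_row (rows T))"
  proof (cases "tl r = []")
    case True
    then show ?thesis
      using other_columns_singleton[OF ssyt True] ne T by (simp add: rows other_columns_def)
  next
    case False
    then show ?thesis using ne T by (simp add: rows other_columns_def)
  qed
  ultimately show thesis using that sum by blast
qed

section \<open>Columns occurring in product relations\<close>

lemma is_ssyt_column:
  "is_ssyt (map (\<lambda>a. [a]) as) \<longleftrightarrow> sorted_wrt (<) as \<and> (\<forall>a\<in>set as. 0 < a)"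
proof (induction as)
  case Nil
  then show ?case by (simp add: is_ssyt_Nil)
next
  case (Cons a as)
  have "fits_below [a] (hd_row (map (\<lambda>a. [a]) as)) \<longleftrightarrow> (as = [] \<or> a < hd as)"
    by (cases as) (simp_all add: fits_below_iff)
  moreover have "sorted_wrt (<) as \<Longrightarrow> as = [] \<or> a < hd as \<longleftrightarrow> (\<forall>b\<in>set as. a < b)"
    by (cases as) auto
  ultimately show ?case using Cons by (auto simp: is_ssyt_Cons)
qed

lemma rows_column:
  "sorted_wrt (<) as \<Longrightarrow> \<forall>a\<in>set as. 0 < a \<Longrightarrow> rows (column as) = map (\<lambda>a. [a]) as"
  unfolding column_def by (rule Abs_ssyt_inverse) (simp add: is_ssyt_column)

lemma row_mset_column:
  "sorted_wrt (<) as \<Longrightarrow> \<forall>a\<in>set as. 0 < a \<Longrightarrow>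
     row_mset (column as) i = (if i < length as then {#as ! i#} else {#})"
  by (simp add: row_mset_def rows_column)

lemma G_setE:
  assumes "T \<in> G_set n m"
  obtains as where "T = column as" "as \<noteq> []" "sorted_wrt (<) as" "\<forall>a\<in>set as. 0 < a \<and> a \<le> m"
    "length as \<le> n"
proof -
  define as where "as = map hd (rows T)"
  have "map (\<lambda>a. [a]) as = map (\<lambda>r. [hd r]) (rows T)" by (simp add: as_def)
  also have "\<dots> = rows T"
    by (rule map_idI) (use assms in \<open>auto simp: G_set_def length_Suc_conv\<close>)
  finally have rows: "rows T = map (\<lambda>a. [a]) as" by simp
  then have as: "sorted_wrt (<) as \<and> (\<forall>a\<in>set as. 0 < a)"
    using is_ssyt_rows[of T] by (simp add: is_ssyt_column)
  have "T = column as" using rows by (metis column_def rows_inverse)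
  moreover have "as \<noteq> []" "\<forall>a\<in>set as. a \<le> m" "length as \<le> n"
    using assms rows by (auto simp: G_set_def SSYT_def)
  ultimately show thesis using that[of as] as by blast
qed

text \<open>
  In a strictly increasing list of positive integers the entry at index \<open>k\<close> is at least
  \<open>k + 1\<close>; equality at one index forces equality at all earlier ones.
\<close>

lemma take_eq_upt:
  assumes "sorted_wrt (<) as" "\<forall>a\<in>set as. (0::nat) < a" "k < length as" "as ! k = Suc k"
  shows "take (Suc k) as = [1..<Suc (Suc k)]"
  using assms(3,4)
proof (induction k)
  case 0
  then show ?case by (cases as) auto
next
  case (Suc k)
  have lower: "Suc j \<le> as ! j" if "j < length as" for j
    using that
  proof (induction j)
    case 0
    then show ?case using assms(2) by (simp add: Suc_le_eq)
  next
    case (Suc j)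
    then have "as ! j < as ! Suc j" using assms(1) by (simp add: sorted_wrt_nth_less)
    then show ?case using Suc by simp
  qed
  have "as ! k < as ! Suc k" using sorted_wrt_nth_less[OF assms(1), of k "Suc k"] Suc.prems by simp
  then have "as ! k = Suc k" using lower[of k] Suc.prems by simp
  then have "take (Suc k) as = [1..<Suc (Suc k)]" using Suc.IH Suc.prems by simp
  then show ?case using Suc.prems by (simp add: take_Suc_conv_app_nth[of "Suc k"])
qed

text \<open>
  The row contents of both sides agree, so an entry of \<open>a\<close> in a given row also occurs in that row of
  \<open>c\<close> or \<open>e\<close>. The members of \<open>F_set n m\<close> have an entry in an extremal position: only
  \<open>[1,...,n]\<close> has \<open>n\<close> in the row \<open>n\<close>, and only \<open>[m]\<close> has \<open>m\<close> in the first row. For \<open>m = n\<close>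
  the entry \<open>n - 1\<close> in row \<open>n - 1\<close> leaves \<open>[1,...,n-1]\<close> and \<open>[1,...,n]\<close>, and the second of
  these has been excluded. In each case \<open>c\<close> or \<open>e\<close> coincides with \<open>a\<close> or \<open>b\<close>.
\<close>

lemma product_relation_not_F:
  assumes G: "{a, b, c, e} \<subseteq> G_set n m" and distinct: "distinct [a, b, c, e]"
    and eq: "a + b = c + e" and "1 \<le> n" "n \<le> m"
  shows "a \<notin> F_set n m"
proof
  assume F: "a \<in> F_set n m"
  have transfer: "\<exists>d\<in>{c, e}. x \<in># row_mset d i" if "x \<in># row_mset a i" for x i
    using that row_mset_add[of a b i] row_mset_add[of c e i] eq by (metis insert_iff union_iff)
  have initial: "\<exists>bs. d = column ([1..<Suc k] @ bs) \<and> length bs \<le> n - k \<and>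
      sorted_wrt (<) ([1..<Suc k] @ bs) \<and> (\<forall>x\<in>set bs. x \<le> m)"
    if d: "d \<in> G_set n m" and k: "0 < k" "k \<in># row_mset d (k - 1)" for d k
  proof -
    obtain as where as: "d = column as" "sorted_wrt (<) as" "\<forall>x\<in>set as. 0 < x \<and> x \<le> m"
      "length as \<le> n"
      using G_setE[OF d] by metis
    have "k - 1 < length as" "as ! (k - 1) = Suc (k - 1)"
      using as k by (simp_all add: row_mset_column split: if_splits)
    then have "take k as = [1..<Suc k]"
      using take_eq_upt[of as "k - 1"] as k(1) by simp
    then have "as = [1..<Suc k] @ drop k as" by (metis append_take_drop_id)
    moreover have "\<forall>x\<in>set (drop k as). x \<le> m" using as(3) in_set_dropD by fast
    ultimately show ?thesis using as(1,2,4) by (intro exI[of _ "drop k as"]) simp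
  qed
  have full: "d = column [1..<Suc n]" if d: "d \<in> G_set n m" "n \<in># row_mset d (n - 1)" for d
    using initial[OF d(1) _ d(2)] \<open>1 \<le> n\<close> by auto
  have upt: "sorted_wrt (<) [1..<Suc k]" "\<forall>x\<in>set [1..<Suc k]. 0 < x" for k :: nat
    by (simp_all del: upt_Suc)
  have not_full: "a \<noteq> column [1..<Suc n]"
  proof
    assume a: "a = column [1..<Suc n]"
    then have "n \<in># row_mset a (n - 1)"
      using \<open>1 \<le> n\<close> by (simp only: row_mset_column[OF upt]) (simp del: upt_Suc)
    then obtain d where "d \<in> {c, e}" "n \<in># row_mset d (n - 1)" using transfer by blast
    then show False using full[of d] G distinct a by auto
  qed
  have not_m: "a \<noteq> column [m]"
  proof
    assume a: "a = column [m]"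
    then have "m \<in># row_mset a 0" using assms by (simp add: row_mset_column)
    then obtain d where d: "d \<in> {c, e}" "m \<in># row_mset d 0" using transfer by blast
    then have "d \<in> G_set n m" using G by auto
    then obtain as where as: "d = column as" "as \<noteq> []" "sorted_wrt (<) as"
      "\<forall>x\<in>set as. 0 < x \<and> x \<le> m"
      by (rule G_setE)
    then have "as = [m]"
      using d(2) by (cases as; cases "tl as") (auto simp: row_mset_column)
    then show False using as d distinct a by auto
  qed
  from F not_full not_m have mn: "m = n" "n \<noteq> 1" "a = column [1..<n]"
    by (auto simp: F_set_def split: if_splits)
  then obtain k where k: "n = Suc k" "0 < k" using \<open>1 \<le> n\<close> by (cases n) auto
  have "k \<in># row_mset a (k - 1)"
    unfolding mn(3) k(1) row_mset_column[OF upt] using k(2) by (simp del: upt_Suc)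
  then obtain d where d: "d \<in> {c, e}" "k \<in># row_mset d (k - 1)" using transfer by blast
  then have dG: "d \<in> G_set n m" using G by auto
  obtain bs where bs: "d = column ([1..<Suc k] @ bs)" "length bs \<le> 1"
    "sorted_wrt (<) ([1..<Suc k] @ bs)" "\<forall>x\<in>set bs. x \<le> n"
    using initial[OF dG k(2) d(2)] k mn by auto
  have "bs = [] \<or> bs = [n]"
  proof (cases bs)
    case (Cons x xs)
    then have "xs = []" using bs(2) by simp
    moreover have "k < x" using bs(3) Cons k(2) by (auto simp: sorted_wrt_append)
    ultimately show ?thesis using Cons bs(4) k by auto
  qed simp
  then show False
  proof
    assume "bs = []"
    then show False using bs(1) d(1) mn k distinct by (auto simp del: upt_Suc)
  next
    assume "bs = [n]"
    then have dfull: "d = column [1..<Suc n]" using bs(1) k by simp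
    \<comment> \<open>now the full column is a factor on the right, so it must also be one on the left\<close>
    then have "n \<in># row_mset d (n - 1)"
      using \<open>1 \<le> n\<close> by (simp only: row_mset_column[OF upt]) (simp del: upt_Suc)
    then have "n \<in># row_mset (a + b) (n - 1)"
      using d(1) eq by (auto simp: row_mset_add)
    then have "n \<in># row_mset a (n - 1) \<or> n \<in># row_mset b (n - 1)"
      by (simp add: row_mset_add)
    then have "a = column [1..<Suc n] \<or> b = column [1..<Suc n]" using full G by auto
    then show False using dfull d(1) distinct by auto
  qed
qed

section \<open>The quotients of the tableaux algebra\<close>

lemma tableaux_algebra_simps:
  "carrier (tableaux_algebra n m) = {f. Poly_Mapping.keys f \<subseteq> SSYT n m}"
  "f \<oplus>\<^bsub>tableaux_algebra n m\<^esub> g = f + g"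
  "f \<otimes>\<^bsub>tableaux_algebra n m\<^esub> g = f * g"
  "\<zero>\<^bsub>tableaux_algebra n m\<^esub> = 0"
  "\<one>\<^bsub>tableaux_algebra n m\<^esub> = 1"
  by (simp_all add: tableaux_algebra_def monoid_algebra_def)

lemma cring_tableaux_algebra: "cring (tableaux_algebra n m :: (ssyt \<Rightarrow>\<^sub>0 'k::comm_ring_1) ring)"
  unfolding tableaux_algebra_def by (rule cring_monoid_algebra[OF zero_in_SSYT add_in_SSYT])

lemma M_ideal_generators:
  "{Poly_Mapping.single T 1 - Poly_Mapping.single 0 (t T) | T. T \<in> G_set n m}
     \<subseteq> carrier (tableaux_algebra n m :: (ssyt \<Rightarrow>\<^sub>0 'k::comm_ring_1) ring)"
proof -
  have "Poly_Mapping.keys (Poly_Mapping.single T (1::'k) - Poly_Mapping.single 0 (t T)) \<subseteq> {T, 0}" for T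
    by (auto simp: in_keys_iff lookup_minus lookup_single when_def split: if_splits)
  moreover have "{T, 0} \<subseteq> SSYT n m" if "T \<in> G_set n m" for T
    using that zero_in_SSYT by (simp add: G_set_def)
  ultimately show ?thesis unfolding tableaux_algebra_simps by blast
qed

lemma ideal_M_ideal:
  "ideal (M_ideal n m t) (tableaux_algebra n m :: (ssyt \<Rightarrow>\<^sub>0 'k::comm_ring_1) ring)"
  unfolding M_ideal_def
  by (rule ring.genideal_ideal[OF cring.axioms(1)[OF cring_tableaux_algebra] M_ideal_generators])

text \<open>
  Splitting off the first column \<open>C\<close>, the congruences \<open>C \<equiv> t C\<close> and \<open>T' \<equiv> c\<close> multiply to
  \<open>C \<star> T' \<equiv> t C * c\<close>.
\<close>

lemma tableau_scalar_mod_M_ideal: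
  fixes t :: "ssyt \<Rightarrow> 'k::comm_ring_1"
  assumes "T \<in> SSYT n m"
  shows "\<exists>c. Poly_Mapping.single T 1 - Poly_Mapping.single 0 c \<in> M_ideal n m t"
  using assms
proof (induction "length (hd_row (rows T))" arbitrary: T rule: less_induct)
  case less
  let ?A = "tableaux_algebra n m :: (ssyt \<Rightarrow>\<^sub>0 'k) ring"
  interpret ideal "M_ideal n m t" ?A by (rule ideal_M_ideal)
  show ?case
  proof (cases "T = 0")
    case True
    then have "Poly_Mapping.single T 1 - Poly_Mapping.single 0 1 = \<zero>\<^bsub>?A\<^esub>"
      by (simp add: tableaux_algebra_simps)
    then show ?thesis using additive_subgroup.zero_closed[OF is_additive_subgroup] by metis
  next
    case False
    obtain C T' where CT: "C \<in> G_set n m" "T' \<in> SSYT n m" "T = C + T'"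
      "length (hd_row (rows T')) < length (hd_row (rows T))"
      using split_first_column[OF less.prems False] by metis
    obtain c where c: "Poly_Mapping.single T' 1 - Poly_Mapping.single 0 c \<in> M_ideal n m t"
      using less.hyps[OF CT(4,2)] by blast
    have gen: "Poly_Mapping.single C 1 - Poly_Mapping.single 0 (t C) \<in> M_ideal n m t"
      using ring.genideal_self[OF ring_axioms M_ideal_generators[of t n m]] CT(1)
      unfolding M_ideal_def by blast
    have "Poly_Mapping.single C (1::'k) \<in> carrier ?A" "Poly_Mapping.single 0 c \<in> carrier ?A"
      using CT(1) zero_in_SSYT by (auto simp: tableaux_algebra_simps G_set_def)
    then have "Poly_Mapping.single C 1 * (Poly_Mapping.single T' 1 - Poly_Mapping.single 0 c)
        + (Poly_Mapping.single C 1 - Poly_Mapping.single 0 (t C)) * Poly_Mapping.single 0 c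
        \<in> M_ideal n m t"
      using I_l_closed[OF c] I_r_closed[OF gen]
        additive_subgroup.a_closed[OF is_additive_subgroup] by (simp add: tableaux_algebra_simps)
    moreover have "Poly_Mapping.single C 1 * (Poly_Mapping.single T' 1 - Poly_Mapping.single 0 c)
        + (Poly_Mapping.single C 1 - Poly_Mapping.single 0 (t C)) * Poly_Mapping.single 0 c
        = Poly_Mapping.single T 1 - Poly_Mapping.single 0 (t C * c)"
      by (simp add: CT(3) algebra_simps mult_single)
    ultimately show ?thesis by auto
  qed
qed

lemma scalar_mod_M_ideal:
  fixes t :: "ssyt \<Rightarrow> 'k::comm_ring_1"
  assumes "f \<in> carrier (tableaux_algebra n m)"
  shows "\<exists>c. f - Poly_Mapping.single 0 c \<in> M_ideal n m t"
proof -
  let ?A = "tableaux_algebra n m :: (ssyt \<Rightarrow>\<^sub>0 'k) ring"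
  interpret ideal "M_ideal n m t" ?A by (rule ideal_M_ideal)
  obtain c where c: "Poly_Mapping.single T 1 - Poly_Mapping.single 0 (c T) \<in> M_ideal n m t"
    if "T \<in> SSYT n m" for T
    using tableau_scalar_mod_M_ideal[of _ n m t] by metis
  have sum_in: "(\<Sum>s\<in>B. h s) \<in> M_ideal n m t" if "finite B" "\<And>s. s \<in> B \<Longrightarrow> h s \<in> M_ideal n m t" for B and h :: "ssyt \<Rightarrow> _"
    using that
    using additive_subgroup.zero_closed[OF is_additive_subgroup] additive_subgroup.a_closed[OF is_additive_subgroup]
    by (induction B) (simp_all add: tableaux_algebra_simps)
  let ?l = "Poly_Mapping.lookup f" and ?K = "Poly_Mapping.keys f"
  have "(\<Sum>T\<in>?K. Poly_Mapping.single 0 (?l T) * (Poly_Mapping.single T 1 - Poly_Mapping.single 0 (c T)))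
      \<in> M_ideal n m t"
  proof (rule sum_in)
    fix T assume "T \<in> ?K"
    then have "T \<in> SSYT n m" using assms by (auto simp: tableaux_algebra_simps)
    moreover have "Poly_Mapping.single 0 (?l T) \<in> carrier ?A"
      using zero_in_SSYT by (simp add: tableaux_algebra_simps)
    ultimately show "Poly_Mapping.single 0 (?l T) * (Poly_Mapping.single T 1 - Poly_Mapping.single 0 (c T))
        \<in> M_ideal n m t"
      using I_l_closed[OF c] by (simp add: tableaux_algebra_simps)
  qed simp
  also have "(\<Sum>T\<in>?K. Poly_Mapping.single 0 (?l T) * (Poly_Mapping.single T 1 - Poly_Mapping.single 0 (c T)))
      = f - Poly_Mapping.single 0 (\<Sum>T\<in>?K. ?l T * c T)"
  proof -
    have single_sum: "Poly_Mapping.single 0 (\<Sum>T\<in>B. h T) = (\<Sum>T\<in>B. Poly_Mapping.single 0 (h T))"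
      if "finite B" for B and h :: "ssyt \<Rightarrow> 'k"
      using that by (induction B) (simp_all add: single_add)
    show ?thesis
      by (simp add: right_diff_distrib mult_single sum_subtractf single_sum sum_single_lookup)
  qed
  finally show ?thesis by blast
qed

text \<open>
  An element of a larger ideal outside \<open>M_ideal n m t\<close> is congruent to a nonzero scalar, which
  is a unit.
\<close>

lemma maximal_M_ideal:
  fixes t :: "ssyt \<Rightarrow> 'k::field"
  assumes proper: "M_ideal n m t \<noteq> carrier (tableaux_algebra n m)"
  shows "maximalideal (M_ideal n m t) (tableaux_algebra n m)"
proof -
  let ?A = "tableaux_algebra n m :: (ssyt \<Rightarrow>\<^sub>0 'k) ring"
  show ?thesis
  proof (rule maximalidealI[OF ideal_M_ideal])
    show "carrier ?A \<noteq> M_ideal n m t" using proper by simp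
    fix J assume J: "ideal J ?A" "M_ideal n m t \<subseteq> J" "J \<subseteq> carrier ?A"
    interpret J: ideal J ?A by (rule J(1))
    show "J = M_ideal n m t \<or> J = carrier ?A"
    proof (cases "J = M_ideal n m t")
      case False
      then obtain f where f: "f \<in> J" "f \<notin> M_ideal n m t" using J(2) by blast
      obtain c where c: "f - Poly_Mapping.single 0 c \<in> M_ideal n m t"
        using scalar_mod_M_ideal[of f n m t] f(1) J(3) by blast
      have "c \<noteq> 0" using c f(2) by auto
      have scalar: "Poly_Mapping.single 0 d \<in> carrier ?A" for d :: 'k
        using zero_in_SSYT by (simp add: tableaux_algebra_simps)
      have "(f - Poly_Mapping.single 0 c) * Poly_Mapping.single 0 (- inverse c)
          + f * Poly_Mapping.single 0 (inverse c) \<in> J"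
        using J.I_r_closed[OF subsetD[OF J(2) c] scalar] J.I_r_closed[OF f(1) scalar]
          additive_subgroup.a_closed[OF J.is_additive_subgroup]
        by (simp add: tableaux_algebra_simps)
      also have "(f - Poly_Mapping.single 0 c) * Poly_Mapping.single 0 (- inverse c)
          + f * Poly_Mapping.single 0 (inverse c) = 1"
        using \<open>c \<noteq> 0\<close> by (simp add: left_diff_distrib mult_single single_uminus)
      finally have "J = carrier ?A" using J.one_imp_carrier by (simp add: tableaux_algebra_simps)
      then show ?thesis ..
    qed simp
  qed
qed

section \<open>Characters of tableaux and points\<close>

lemma M_ideal_subset_kernel:
  fixes \<chi> :: "ssyt \<Rightarrow> 'k::comm_ring_1"
  assumes "\<chi> 0 = 1" "\<And>S T. \<chi> (S + T) = \<chi> S * \<chi> T"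
  shows "M_ideal n m (restrict \<chi> (G_set n m)) \<subseteq> {f. eval_at \<chi> f = 0}"
proof -
  let ?A = "tableaux_algebra n m :: (ssyt \<Rightarrow>\<^sub>0 'k) ring"
  let ?K = "{f \<in> carrier ?A. eval_at \<chi> f = 0}"
  interpret cring ?A by (rule cring_tableaux_algebra)
  have "ideal ?K ?A"
    unfolding tableaux_algebra_def
    by (rule ideal_kernel_eval_at[OF zero_in_SSYT add_in_SSYT assms(2)])
  moreover have "{Poly_Mapping.single T 1 - Poly_Mapping.single 0 (restrict \<chi> (G_set n m) T) | T.
      T \<in> G_set n m} \<subseteq> ?K"
    using M_ideal_generators[of "restrict \<chi> (G_set n m)" n m] assms(1)
    by (auto simp: eval_at_diff)
  ultimately have "M_ideal n m (restrict \<chi> (G_set n m)) \<subseteq> ?K"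
    unfolding M_ideal_def by (rule genideal_minimal)
  then show ?thesis by blast
qed

lemma poly_eval_eq_eval_at: "poly_eval t = eval_at (\<lambda>mon. \<Prod>v\<in>#mon. t v)"
  by (rule ext) (simp add: poly_eval_def eval_at_def)

lemma product_relations_in_E:
  assumes "1 \<le> n" "n \<le> m" "{a, b, c, e} \<subseteq> G_set n m" "distinct [a, b, c, e]" "a + b = c + e"
  shows "{a, b, c, e} \<subseteq> E_set n m"
proof -
  have "a \<notin> F_set n m" "c \<notin> F_set n m"
    using product_relation_not_F[of a b c e n m] product_relation_not_F[of c e a b n m] assms by auto
  moreover have "b \<notin> F_set n m" "e \<notin> F_set n m"
    using product_relation_not_F[of b a c e n m] product_relation_not_F[of e c a b n m] assms
    by (auto simp: add.commute)
  ultimately show ?thesis using assms(3) by (auto simp: E_set_def)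
qed

text \<open>
  At a character, a product relation \<open>T\<^sub>a T\<^sub>b - T\<^sub>c T\<^sub>e\<close> takes the value
  \<open>\<chi> (a + b) - \<chi> (c + e) = 0\<close>.
\<close>

lemma restrict_character_in_points:
  fixes \<chi> :: "ssyt \<Rightarrow> 'k::comm_ring_1"
  assumes nm: "1 \<le> n" "n \<le> m" and \<chi>: "\<And>S T. \<chi> (S + T) = \<chi> S * \<chi> T"
  shows "restrict \<chi> (G_set n m) \<in> points n m"
proof -
  let ?E = "E_set n m" and ?t = "restrict \<chi> (E_set n m)"
  let ?P = "polynomial_ring ?E :: (ssyt multiset \<Rightarrow>\<^sub>0 'k) ring"
  let ?K = "{p \<in> carrier ?P. eval_at (\<lambda>mon. \<Prod>v\<in>#mon. ?t v) p = 0}"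
  have "ideal ?K ?P"
    unfolding polynomial_ring_def by (rule ideal_kernel_eval_at) auto
  moreover have "product_relations n m \<subseteq> ?K"
  proof
    fix p :: "ssyt multiset \<Rightarrow>\<^sub>0 'k" assume "p \<in> product_relations n m"
    then obtain a b c e where p: "p = Var a * Var b - Var c * Var e"
      and abce: "{a, b, c, e} \<subseteq> G_set n m" "distinct [a, b, c, e]" "a + b = c + e"
      by (auto simp: product_relations_def)
    have E: "{a, b, c, e} \<subseteq> ?E" by (rule product_relations_in_E[OF nm abce])
    have p': "p = Poly_Mapping.single {#a, b#} 1 - Poly_Mapping.single {#c, e#} 1"
      by (simp add: p Var_def mult_single add_mset_commute)
    then have "Poly_Mapping.keys p \<subseteq> {{#a, b#}, {#c, e#}}"
      by (auto simp: in_keys_iff lookup_minus lookup_single when_def split: if_splits)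
    then have "p \<in> carrier ?P" using E by (auto simp: polynomial_ring_def monoid_algebra_def)
    moreover have "eval_at (\<lambda>mon. \<Prod>v\<in>#mon. ?t v) p = 0"
      using E abce(3) by (simp add: p' eval_at_diff flip: \<chi>)
    ultimately show "p \<in> ?K" by simp
  qed
  ultimately have "P_ideal n m \<subseteq> ?K"
    unfolding P_ideal_def genideal_def by blast
  then have "\<forall>p\<in>P_ideal n m. poly_eval ?t p = 0"
    unfolding poly_eval_eq_eval_at by blast
  then have "?t \<in> zero_locus ?E (P_ideal n m)"
    unfolding zero_locus_def by (intro CollectI conjI) auto
  moreover have "restrict (restrict \<chi> (G_set n m)) ?E = ?t"
    by (auto simp: E_set_def restrict_def fun_eq_iff)
  ultimately show ?thesis by (simp add: points_def)
qed

definition cell_prime :: "nat \<times> nat \<Rightarrow> nat" where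
  "cell_prime x = enumerate {p. Factorial_Ring.prime p} (prod_encode x)"

lemma prime_cell_prime: "Factorial_Ring.prime (cell_prime x)"
  using enumerate_in_set[OF primes_infinite] by (simp add: cell_prime_def)

lemma inj_cell_prime: "inj cell_prime"
  unfolding cell_prime_def
  using strict_mono_enumerate[OF primes_infinite] inj_prod_encode[of UNIV]
  by (auto simp: inj_def dest!: strict_mono_eq[THEN iffD1])

text \<open>
  The cells of the first \<open>n\<close> rows. Cutting at a fixed \<open>n\<close> makes this additive on all tableaux, so
  that \<open>goedel n\<close> is a character of the whole monoid, and loses nothing on \<open>SSYT n m\<close>.
\<close>

definition entries :: "nat \<Rightarrow> ssyt \<Rightarrow> (nat \<times> nat) multiset" where
  "entries n T = (\<Sum>i<n. image_mset (Pair i) (row_mset T i))"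

definition goedel :: "nat \<Rightarrow> ssyt \<Rightarrow> nat" where
  "goedel n T = prod_mset (image_mset cell_prime (entries n T))"

lemma count_entries: "i < n \<Longrightarrow> count (entries n T) (i, a) = count (row_mset T i) a"
proof -
  assume i: "i < n"
  have *: "count (image_mset (Pair j) M) (i, a) = (if j = i then count M a else 0)" for j M
    by (induction M) auto
  show ?thesis unfolding entries_def using i by (simp add: count_sum *)
qed

lemma goedel_add: "goedel n (S + T) = goedel n S * goedel n T"
  by (simp add: goedel_def entries_def row_mset_add sum.distrib)

lemma goedel_0 [simp]: "goedel n 0 = 1"
  by (simp add: goedel_def entries_def)

lemma inj_on_goedel: "inj_on (goedel n) (SSYT n m)"
proof
  fix S T assume ST: "S \<in> SSYT n m" "T \<in> SSYT n m" and eq: "goedel n S = goedel n T"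
  have "prime_factorization (goedel n U) = image_mset cell_prime (entries n U)" for U
    unfolding goedel_def
    by (rule prime_factorization_prod_mset_primes) (auto simp: prime_cell_prime)
  then have "image_mset cell_prime (entries n S) = image_mset cell_prime (entries n T)"
    using eq by metis
  then have entries: "entries n S = entries n T"
    by (rule injD[OF multiset.inj_map[OF inj_cell_prime]])
  show "S = T"
  proof (rule ssyt_eqI_row_mset)
    show "length (rows S) \<le> n" "length (rows T) \<le> n" using ST by (auto simp: SSYT_def)
    show "row_mset S i = row_mset T i" if "i < n" for i
      using count_entries[OF that, of S] count_entries[OF that, of T] entries
      by (intro multiset_eqI) simp
  qed
qed

lemma ex_character_nonzero:
  fixes f :: "ssyt \<Rightarrow>\<^sub>0 'k::field_char_0"
  assumes "f \<in> carrier (tableaux_algebra n m)" "f \<noteq> 0"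
  obtains \<chi> :: "ssyt \<Rightarrow> 'k"
  where "\<chi> 0 = 1" "\<And>S T. \<chi> (S + T) = \<chi> S * \<chi> T" "eval_at \<chi> f \<noteq> 0"
proof -
  let ?v = "\<lambda>T. of_nat (goedel n T) :: 'k"
  have "\<exists>k. eval_at (\<lambda>T. ?v T ^ k) f \<noteq> 0"
  proof (rule ccontr)
    assume "\<not> ?thesis"
    then have zero: "(\<Sum>T\<in>Poly_Mapping.keys f. Poly_Mapping.lookup f T * ?v T ^ k) = 0" for k
      by (simp add: eval_at_def)
    have "inj_on (goedel n) (Poly_Mapping.keys f)"
      using assms(1) inj_on_subset[OF inj_on_goedel] by (simp add: tableaux_algebra_simps)
    then have inj: "inj_on ?v (Poly_Mapping.keys f)" by (auto simp: inj_on_def)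
    have "Poly_Mapping.lookup f T = 0" for T
    proof (cases "T \<in> Poly_Mapping.keys f")
      case True
      then show ?thesis by (intro separate_by_powers[OF finite_keys inj zero])
    qed (simp add: in_keys_iff)
    then have "f = 0" by (intro poly_mapping_eqI) simp
    with assms(2) show False ..
  qed
  then obtain k where "eval_at (\<lambda>T. ?v T ^ k) f \<noteq> 0" ..
  then show thesis
    by (intro that[of "\<lambda>T. ?v T ^ k"]) (simp_all add: goedel_add power_mult_distrib)
qed

section \<open>The faithful semisimple module\<close>

theorem proposition4p3:
  fixes n m :: nat
  assumes "1 \<le> n" and "n \<le> m"
  shows
    "let A = (tableaux_algebra n m :: (ssyt \<Rightarrow>\<^sub>0 'k::{alg_closed_field, field_char_0}) ring);
         M = direct_sum (points n m) (\<lambda>t. quotient_module A (M_ideal n m t))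
     in faithful_module A M \<and> semisimple_module A M"
proof -
  let ?A = "tableaux_algebra n m :: (ssyt \<Rightarrow>\<^sub>0 'k) ring"
  let ?Q = "\<lambda>t. quotient_module ?A (M_ideal n m t)"
  interpret module_family ?A "points n m" ?Q
    by (rule module_family.intro[OF cring_tableaux_algebra
          module_quotient_module[OF cring_tableaux_algebra ideal_M_ideal]])
  have "faithful_module ?A D"
  proof (rule faithful_direct_sum)
    fix f assume f: "f \<in> carrier ?A"
      and zero: "\<And>t C. t \<in> points n m \<Longrightarrow> C \<in> carrier (?Q t) \<Longrightarrow> f \<odot>\<^bsub>?Q t\<^esub> C = \<zero>\<^bsub>?Q t\<^esub>"
    show "f = \<zero>\<^bsub>?A\<^esub>"
    proof (rule ccontr)
      assume "f \<noteq> \<zero>\<^bsub>?A\<^esub>"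
      then have "f \<noteq> 0" by (simp add: tableaux_algebra_simps)
      then obtain \<chi> :: "ssyt \<Rightarrow> 'k" where \<chi>: "\<chi> 0 = 1" "\<And>S T. \<chi> (S + T) = \<chi> S * \<chi> T"
        and nonzero: "eval_at \<chi> f \<noteq> 0"
        using ex_character_nonzero[OF f] by metis
      let ?t = "restrict \<chi> (G_set n m)"
      have "?t \<in> points n m" by (rule restrict_character_in_points[OF assms \<chi>(2)])
      then have "f \<in> M_ideal n m ?t"
        by (intro annihilator_quotient_module[OF ideal_M_ideal f] zero)
      then show False using M_ideal_subset_kernel[OF \<chi>, of n m] nonzero by blast
    qed
  qed
  moreover have "semisimple_module ?A D"
  proof (rule semisimple_direct_sum)
    fix t assume "t \<in> points n m" and nonzero: "carrier (?Q t) \<noteq> {\<zero>\<^bsub>?Q t\<^esub>}"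
    have "M_ideal n m t \<noteq> carrier ?A"
    proof
      assume whole: "M_ideal n m t = carrier ?A"
      interpret M: ideal "M_ideal n m t" ?A by (rule ideal_M_ideal)
      have "C = M_ideal n m t" if "C \<in> carrier (?Q t)" for C
        using that M.a_rcos_const unfolding carrier_quotient_module whole by blast
      then show False using nonzero unfolding zero_quotient_module
        using abelian_monoid.zero_closed[OF abelian_monoid_component[OF \<open>t \<in> points n m\<close>]]
        unfolding zero_quotient_module by blast
    qed
    then show "simple_module ?A (?Q t)"
      by (intro simple_quotient_module cring_tableaux_algebra maximal_M_ideal)
  qed
  ultimately show ?thesis by (simp add: Let_def)
qed

end
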